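(* For any $d\ge 5$ and $n$, there exists a graph with $n$ vertices and maximum degree $d$ whose slope number is at least $n^{\frac12-\frac1{d-2}-o(1)}$.
   Context: A straight-line drawing of a graph maps vertices to distinct points of the plane and edges to segments between the corresponding points not passing through any other vertex point (crossings allowed). The slope number of a graph $G$ is the smallest $s$ such that $G$ has a straight-line drawing whose edges have at most $s$ distinct slopes. *)

theory Defs
  imports "HOL-Analysis.Analysis"
begin

text \<open>Finite simple graphs, given by a vertex set and a set of two-element edges.\<close>

definition simple_graph :: "'a set \<Rightarrow> 'a set set \<Rightarrow> bool" where
  "simple_graph V E \<longleftrightarrow> finite V \<and> (\<forall>e\<in>E. e \<subseteq> V \<and> card e = 2)"

definition degree :: "'a set set \<Rightarrow> 'a \<Rightarrow> nat" where
  "degree E v = card {e \<in> E. v \<in> e}"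

definition max_degree :: "'a set \<Rightarrow> 'a set set \<Rightarrow> nat" where
  "max_degree V E = Max (degree E ` V)"

definition straight_line_drawing ::
    "'a set \<Rightarrow> 'a set set \<Rightarrow> ('a \<Rightarrow> real \<times> real) \<Rightarrow> bool" where
  "straight_line_drawing V E p \<longleftrightarrow>
     inj_on p V \<and>
     (\<forall>u v w. {u, v} \<in> E \<and> w \<in> V - {u, v} \<longrightarrow> p w \<notin> closed_segment (p u) (p v))"

text \<open>The slope of the line through two distinct points; vertical lines have slope \<open>\<infinity>\<close>.
  It is symmetric in the two points.\<close>

definition slope :: "real \<times> real \<Rightarrow> real \<times> real \<Rightarrow> ereal" where
  "slope a b =
     (if fst a = fst b then \<infinity> else ereal ((snd b - snd a) / (fst b - fst a)))"

definition edge_slopes :: "'a set set \<Rightarrow> ('a \<Rightarrow> real \<times> real) \<Rightarrow> ereal set" where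
  "edge_slopes E p = {slope (p u) (p v) | u v. {u, v} \<in> E}"

text \<open>Every finite simple graph has a straight-line drawing (put the vertices on a parabola),
  and the set of slopes of a drawing is finite, so the minimum below exists.\<close>

definition slope_number :: "'a set \<Rightarrow> 'a set set \<Rightarrow> nat" where
  "slope_number V E =
     (LEAST s. \<exists>p. straight_line_drawing V E p \<and> card (edge_slopes E p) \<le> s)"

end

theory Submission
  imports Defs "HOL-Combinatorics.Permutations" "HOL-Real_Asymp.Real_Asymp"
begin

text \<open>
  On a frame \<open>0, \<dots>, 2 m - 1\<close>, where \<open>i\<close> is joined to \<open>i + 1\<close> and \<open>i + 2\<close>, put \<open>d - 4\<close> matchings between
  the first and the second half; there are \<open>(m!)\<^sup>d\<^sup>-\<^sup>4\<close> choices. In a drawing with \<open>k\<close> slopes the frame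
  consists of non-degenerate triangles, so the slopes of its edges determine it up to translation and
  scaling. As no vertex lies on an edge, each matching partner is the next vertex on one of at most
  \<open>2 k\<close> rays. Hence the matchings are determined by the assignment of slopes to the frame (\<open>k\<^sup>4\<^sup>m\<close>
  choices), the rays (\<open>(2 k)\<close> to the power \<open>m (d - 4)\<close>), and the signs of polynomially many polynomials
  in the \<open>k\<close> slopes, which record collinearity and order.

  These signs take only \<open>n\<^sup>O\<^sup>(\<^sup>k\<^sup>)\<close> values, by a bound in the spirit of Warren: let \<open>g\<close> be the square of the
  product of the polynomials, cut off outside a cube. On every sign cell the gradient of \<open>g\<close> takes every
  value with sufficiently small positive entries. If \<open>h\<close> is a polynomial separating the \<open>K\<close> cells, then the products of
  \<open>h\<^sup>a\<close> (\<open>a < K\<close>) and the monomials in the partial derivatives of \<open>g\<close> are linearly independent, and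
  comparing their number with the dimension of a space of polynomials bounds \<open>K\<close>.
\<close>

section \<open>Polynomial functions of bounded degree\<close>

text \<open>Gaussian elimination, one equation at a time: equation \<open>j0\<close> either is
  trivial or expresses one unknown by the others.\<close>

lemma homogeneous_system_nontrivial_solution:
  fixes A :: "'j \<Rightarrow> 'i \<Rightarrow> real"
  assumes "finite J" "finite I" "card J < card I"
  shows "\<exists>c. (\<exists>i\<in>I. c i \<noteq> 0) \<and> (\<forall>j\<in>J. (\<Sum>i\<in>I. c i * A j i) = 0)"
  using assms
proof (induction J arbitrary: I A rule: finite_induct)
  case empty
  then have "I \<noteq> {}" by auto
  then show ?case by (intro exI[of _ "\<lambda>_. 1"]) auto
next
  case (insert j0 J)
  show ?case
  proof (cases "\<forall>i\<in>I. A j0 i = 0")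
    case True
    have "card J < card I" using insert by simp
    from insert.IH[OF insert.prems(1) this, of A] True show ?thesis by auto
  next
    case False
    then obtain i0 where i0: "i0 \<in> I" "A j0 i0 \<noteq> 0" by blast
    define I' where "I' = I - {i0}"
    have I: "I = insert i0 I'" "i0 \<notin> I'" "finite I'" using i0 insert.prems by (auto simp: I'_def)
    have "card J < card I'" using insert I by auto
    from insert.IH[OF I(3) this, of "\<lambda>j i. A j i - A j i0 * A j0 i / A j0 i0"] obtain c where
      c: "\<exists>i\<in>I'. c i \<noteq> 0" "\<forall>j\<in>J. (\<Sum>i\<in>I'. c i * (A j i - A j i0 * A j0 i / A j0 i0)) = 0"
      by blast
    \<comment> \<open>The value of the unknown \<open>i0\<close> that equation \<open>j0\<close>
      forces.\<close>
    define s where "s = - (\<Sum>i\<in>I'. c i * A j0 i) / A j0 i0"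
    have sum: "(\<Sum>i\<in>I. (c(i0 := s)) i * A j i) = s * A j i0 + (\<Sum>i\<in>I'. c i * A j i)" for j
    proof -
      have "(\<Sum>i\<in>I'. (c(i0 := s)) i * A j i) = (\<Sum>i\<in>I'. c i * A j i)"
        by (rule sum.cong) (use I in auto)
      then show ?thesis using I by simp
    qed
    have "s * A j0 i0 + (\<Sum>i\<in>I'. c i * A j0 i) = 0" using i0 by (simp add: s_def)
    moreover have "s * A j i0 + (\<Sum>i\<in>I'. c i * A j i) = 0" if "j \<in> J" for j
    proof -
      have "(\<Sum>i\<in>I'. c i * (A j i - A j i0 * A j0 i / A j0 i0)) =
        (\<Sum>i\<in>I'. c i * A j i) - A j i0 / A j0 i0 * (\<Sum>i\<in>I'. c i * A j0 i)"
        by (simp add: sum_subtractf sum_distrib_left algebra_simps)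
      then show ?thesis using c(2) that by (simp add: s_def)
    qed
    moreover have "\<exists>i\<in>I. (c(i0 := s)) i \<noteq> 0" using c(1) I by auto
    ultimately show ?thesis using sum by (intro exI[of _ "c(i0 := s)"]) auto
  qed
qed

text \<open>A nonzero polynomial of degree below \<open>K\<close> has fewer than \<open>K\<close>
  roots. Infinite \<open>S\<close> serves intervals; the other case serves \<open>K\<close> distinct
  values of a separating polynomial.\<close>

lemma real_poly_coeffs_zero:
  fixes b :: "nat \<Rightarrow> real"
  assumes "\<And>t. t \<in> S \<Longrightarrow> (\<Sum>a<K. b a * t ^ a) = 0" "infinite S \<or> card S \<ge> K" "a < K"
  shows "b a = 0"
proof (rule ccontr)
  assume "b a \<noteq> 0"
  obtain n where n: "K = Suc n" using assms(3) by (cases K) auto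
  let ?Z = "{z. (\<Sum>i\<le>n. b i * z ^ i) = 0}"
  have a: "a \<le> n" using assms n by auto
  have sub: "S \<subseteq> ?Z" using assms(1) by (auto simp: n lessThan_Suc_atMost)
  have fin: "finite ?Z" and c: "card ?Z \<le> n"
    using polyfun_rootbound[of n b] \<open>b a \<noteq> 0\<close> a by auto
  from sub fin have "finite S" by (rule finite_subset)
  moreover have "card S \<le> n" using card_mono[OF fin sub] c by simp
  ultimately show False using assms(2) n by auto
qed

abbreviation expos :: "nat \<Rightarrow> nat \<Rightarrow> (nat \<Rightarrow> nat) set" where
  "expos N D \<equiv> PiE {..<N} (\<lambda>_. {..D})"

abbreviation mono_val :: "nat \<Rightarrow> (nat \<Rightarrow> nat) \<Rightarrow> (nat \<Rightarrow> real) \<Rightarrow> real" where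
  "mono_val N \<alpha> x \<equiv> \<Prod>i<N. x i ^ \<alpha> i"

lemma card_expos: "card (expos N D) = Suc D ^ N"
  by (simp add: card_PiE)

text \<open>Induction on the number of variables: with the earlier ones fixed, the coefficients of
  the powers of the last one vanish, because an interval is infinite. Only small positive
  \<open>y\<close> are assumed, as the gradient is known to take just such values.\<close>

lemma poly_vanishing_on_box:
  fixes c :: "(nat \<Rightarrow> nat) \<Rightarrow> real"
  assumes "\<eta> > 0"
    and "\<And>y. (\<forall>i<N. 0 < y i \<and> y i < \<eta>) \<Longrightarrow> (\<Sum>\<alpha>\<in>expos N D. c \<alpha> * mono_val N \<alpha> y) = 0"
    and "\<alpha> \<in> expos N D"
  shows "c \<alpha> = 0"
  using assms(2,3)
proof (induction N arbitrary: c \<alpha>)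
  case 0
  then show ?case by simp
next
  case (Suc N)
  let ?S = "\<lambda>t y. \<Sum>\<alpha>\<in>expos N D. c (\<alpha>(N := t)) * mono_val N \<alpha> y"
  have split: "(\<Sum>\<alpha>\<in>expos (Suc N) D. c \<alpha> * mono_val (Suc N) \<alpha> y) = (\<Sum>t<Suc D. ?S t y * y N ^ t)"
    for y
  proof -
    have set: "expos (Suc N) D = (\<lambda>(t, \<alpha>). \<alpha>(N := t)) ` ({..D} \<times> expos N D)"
      unfolding lessThan_Suc by (rule PiE_insert_eq)
    have inj: "inj_on (\<lambda>(t, \<alpha>). \<alpha>(N := t)) ({..D} \<times> expos N D)"
      by (rule inj_combinator) simp
    have m: "mono_val (Suc N) (\<alpha>(N := t)) y = mono_val N \<alpha> y * y N ^ t" for \<alpha> t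
    proof -
      have "(\<Prod>i<N. y i ^ (\<alpha>(N := t)) i) = mono_val N \<alpha> y" by (rule prod.cong) auto
      then show ?thesis by simp
    qed
    have "(\<Sum>\<alpha>\<in>expos (Suc N) D. c \<alpha> * mono_val (Suc N) \<alpha> y) =
      (\<Sum>(t,\<alpha>)\<in>{..D} \<times> expos N D. c (\<alpha>(N := t)) * (mono_val N \<alpha> y * y N ^ t))"
      unfolding set sum.reindex[OF inj]
      by (rule sum.cong[OF refl]) (simp only: o_def case_prod_beta m)
    also have "\<dots> = (\<Sum>t\<le>D. ?S t y * y N ^ t)"
      unfolding sum.cartesian_product[symmetric] sum_distrib_right by (simp only: mult.assoc)
    finally show ?thesis by (simp add: lessThan_Suc_atMost)
  qed
  have coeff: "?S t y = 0" if y: "\<forall>i<N. 0 < y i \<and> y i < \<eta>" and t: "t < Suc D" for t y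
  proof (rule real_poly_coeffs_zero[where b = "\<lambda>t. ?S t y" and S = "{0<..<\<eta>}" and K = "Suc D"])
    fix s assume "s \<in> {0<..<\<eta>}"
    then have "(\<Sum>\<alpha>\<in>expos (Suc N) D. c \<alpha> * mono_val (Suc N) \<alpha> (y(N := s))) = 0"
      using y by (intro Suc.prems(1)) (auto simp: less_Suc_eq)
    then have "(\<Sum>t<Suc D. ?S t (y(N := s)) * s ^ t) = 0" unfolding split by simp
    moreover have "?S t (y(N := s)) = ?S t y" for t
      by (intro sum.cong refl arg_cong2[where f = "(*)"] prod.cong) auto
    ultimately show "(\<Sum>t<Suc D. ?S t y * s ^ t) = 0" by simp
  qed (use \<open>\<eta> > 0\<close> t in \<open>auto intro!: disjI1 infinite_Ioo\<close>)
  \<comment> \<open>Members of \<open>expos N D\<close> are \<open>undefined\<close> from index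
    \<open>N\<close> on, so the exponent at \<open>N\<close> is split off and reset.\<close>
  have \<alpha>: "\<alpha>(N := undefined) \<in> expos N D" "\<alpha> N \<le> D"
    using Suc.prems(2) by (auto simp: PiE_def Pi_def extensional_def)
  have "(\<lambda>\<beta>. c (\<beta>(N := \<alpha> N))) (\<alpha>(N := undefined)) = 0"
  proof (rule Suc.IH[where c = "\<lambda>\<beta>. c (\<beta>(N := \<alpha> N))"])
    fix y assume "\<forall>i<N. 0 < y i \<and> y i < \<eta>"
    then show "?S (\<alpha> N) y = 0" using coeff \<alpha>(2) by simp
  qed (rule \<alpha>(1))
  then show ?case by simp
qed

text \<open>\<open>D\<close> bounds the degree in each of the \<open>N\<close> variables separately.\<close>

inductive bpoly :: "nat \<Rightarrow> nat \<Rightarrow> ((nat \<Rightarrow> real) \<Rightarrow> real) \<Rightarrow> bool" for N where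
  bpoly_const: "bpoly N D (\<lambda>x. c)"
| bpoly_coord: "i < N \<Longrightarrow> bpoly N (Suc D) (\<lambda>x. x i)"
| bpoly_add: "bpoly N D f \<Longrightarrow> bpoly N D g \<Longrightarrow> bpoly N D (\<lambda>x. f x + g x)"
| bpoly_mult: "bpoly N D f \<Longrightarrow> bpoly N D' g \<Longrightarrow> bpoly N (D + D') (\<lambda>x. f x * g x)"

section \<open>Closure properties and monomial expansion\<close>

lemma bpoly_mono:
  assumes "bpoly N D f" "D \<le> D'"
  shows "bpoly N D' f"
  using bpoly_mult[OF assms(1) bpoly_const[of N "D' - D" 1]] assms(2) by simp

lemma bpoly_mult':
  assumes "bpoly N D f" "bpoly N D' g" "D + D' \<le> D''"
  shows "bpoly N D'' (\<lambda>x. f x * g x)"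
  using bpoly_mono[OF bpoly_mult[OF assms(1,2)] assms(3)] .

lemma bpoly_uminus: "bpoly N D f \<Longrightarrow> bpoly N D (\<lambda>x. - f x)"
  using bpoly_mult[OF bpoly_const[of N 0 "-1"]] by simp

lemma bpoly_diff: "bpoly N D f \<Longrightarrow> bpoly N D g \<Longrightarrow> bpoly N D (\<lambda>x. f x - g x)"
  using bpoly_add[OF _ bpoly_uminus] by simp

lemma bpoly_sum: "(\<And>i. i \<in> I \<Longrightarrow> bpoly N D (f i)) \<Longrightarrow> bpoly N D (\<lambda>x. \<Sum>i\<in>I. f i x)"
proof (induction I rule: infinite_finite_induct)
  case (insert i I)
  then show ?case using bpoly_add[of N D "f i" "\<lambda>x. \<Sum>i\<in>I. f i x"] by simp
qed (simp_all add: bpoly_const)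

lemma bpoly_prod:
  "finite I \<Longrightarrow> (\<And>i. i \<in> I \<Longrightarrow> bpoly N D (f i)) \<Longrightarrow> bpoly N (card I * D) (\<lambda>x. \<Prod>i\<in>I. f i x)"
proof (induction I rule: finite_induct)
  case (insert i I)
  then show ?case using bpoly_mult[of N D "f i" "card I * D" "\<lambda>x. \<Prod>i\<in>I. f i x"] by simp
qed (simp add: bpoly_const)

lemma bpoly_power: "bpoly N D f \<Longrightarrow> bpoly N (n * D) (\<lambda>x. f x ^ n)"
proof (induction n)
  case (Suc n)
  then show ?case using bpoly_mult[of N D f "n * D" "\<lambda>x. f x ^ n"] by simp
qed (simp add: bpoly_const)

lemma continuous_on_bpoly: "bpoly N D f \<Longrightarrow> continuous_on S f"
proof (induction rule: bpoly.induct)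
  case (bpoly_coord i D)
  then show ?case
    by (intro continuous_on_subset[OF continuous_on_product_coordinates]) simp
qed (auto intro: continuous_intros)

text \<open>The bound \<open>D\<close> is kept instead of lowered, so that it passes through the
  product rule by mere addition.\<close>

lemma bpoly_partial_derivative:
  assumes "bpoly N D f"
  shows "\<exists>f'. bpoly N D f' \<and> (\<forall>x. ((\<lambda>t. f (x(i := t))) has_real_derivative f' x) (at (x i)))"
  using assms
proof (induction rule: bpoly.induct)
  case (bpoly_const D c)
  then show ?case by (intro exI[of _ "\<lambda>_. 0"]) (auto intro: bpoly.bpoly_const)
next
  case (bpoly_coord j D)
  show ?case
    by (intro exI[of _ "\<lambda>_. if j = i then 1 else 0"]) (auto intro: bpoly.bpoly_const)
next
  case (bpoly_add D f g)
  then obtain f' g' where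
    "bpoly N D f'" "\<forall>x. ((\<lambda>t. f (x(i := t))) has_real_derivative f' x) (at (x i))"
    "bpoly N D g'" "\<forall>x. ((\<lambda>t. g (x(i := t))) has_real_derivative g' x) (at (x i))"
    by blast
  then show ?case
    by (intro exI[of _ "\<lambda>x. f' x + g' x"]) (auto simp del: fun_upd_apply intro: bpoly.bpoly_add DERIV_add)
next
  case (bpoly_mult D f D' g)
  then obtain f' g' where f':
    "bpoly N D f'" "\<forall>x. ((\<lambda>t. f (x(i := t))) has_real_derivative f' x) (at (x i))"
    "bpoly N D' g'" "\<forall>x. ((\<lambda>t. g (x(i := t))) has_real_derivative g' x) (at (x i))"
    by blast
  have "((\<lambda>t. f (x(i := t)) * g (x(i := t))) has_real_derivative f' x * g x + g' x * f x) (at (x i))"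
    for x
    using DERIV_mult[OF f'(2)[rule_format, of x] f'(4)[rule_format, of x]] by simp
  moreover have "bpoly N (D + D') (\<lambda>x. f' x * g x + g' x * f x)"
    
    by (intro bpoly.bpoly_add bpoly.bpoly_mult bpoly_mult'[OF f'(3) bpoly_mult.hyps(1)] f' bpoly_mult) simp
  ultimately show ?case by blast
qed

lemma bpoly_expansion:
  assumes "bpoly N D f"
  shows "\<exists>c. \<forall>x. f x = (\<Sum>\<alpha>\<in>expos N D. c \<alpha> * mono_val N \<alpha> x)"
proof -
  have single: "\<exists>c. \<forall>x. s * mono_val N \<beta> x = (\<Sum>\<alpha>\<in>expos N D. c \<alpha> * mono_val N \<alpha> x)"
    if "\<beta> \<in> expos N D" for \<beta> D and s :: real
  proof (intro exI allI)
    fix x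
    show "s * mono_val N \<beta> x =
      (\<Sum>\<alpha>\<in>expos N D. (if \<alpha> = \<beta> then s else 0) * mono_val N \<alpha> x)"
      using that by (simp add: if_distrib[of "\<lambda>a. a * _"] sum.delta' finite_PiE cong: if_cong)
  qed
  show ?thesis using assms
  proof (induction rule: bpoly.induct)
    case (bpoly_const D c)
    have "mono_val N (\<lambda>i\<in>{..<N}. 0) x = 1" for x by (intro prod.neutral) auto
    with single[of "\<lambda>i\<in>{..<N}. 0" D c] show ?case by auto
  next
    case (bpoly_coord i D)
    have "mono_val N (\<lambda>j\<in>{..<N}. if j = i then 1 else 0) x = x i" for x
    proof -
      have "mono_val N (\<lambda>j\<in>{..<N}. if j = i then 1 else 0) x = (\<Prod>j<N. if j = i then x j else 1)"
        by (intro prod.cong) auto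
      then show ?thesis using bpoly_coord by simp
    qed
    with single[of "\<lambda>j\<in>{..<N}. if j = i then 1 else 0" "Suc D" 1] show ?case by auto
  next
    case (bpoly_add D f g)
    then obtain a b where "\<forall>x. f x = (\<Sum>\<alpha>\<in>expos N D. a \<alpha> * mono_val N \<alpha> x)"
      "\<forall>x. g x = (\<Sum>\<alpha>\<in>expos N D. b \<alpha> * mono_val N \<alpha> x)" by blast
    then show ?case
      by (intro exI[of _ "\<lambda>\<alpha>. a \<alpha> + b \<alpha>"]) (simp add: distrib_right sum.distrib)
  next
    case (bpoly_mult D f D' g)
    then obtain a b where f: "\<And>x. f x = (\<Sum>\<alpha>\<in>expos N D. a \<alpha> * mono_val N \<alpha> x)"
      and g: "\<And>x. g x = (\<Sum>\<alpha>\<in>expos N D'. b \<alpha> * mono_val N \<alpha> x)" by blast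
    let ?S = "expos N D \<times> expos N D'" and ?T = "expos N (D + D')"
    let ?p = "\<lambda>(\<alpha>,\<beta>). \<lambda>i\<in>{..<N}. \<alpha> i + \<beta> i"
    have p: "?p ` ?S \<subseteq> ?T" by (auto simp: PiE_def Pi_def intro!: add_mono)
    have fin: "finite ?S" "finite ?T" by (auto intro: finite_PiE)
    have mono: "mono_val N (?p z) x = mono_val N (fst z) x * mono_val N (snd z) x" for z x
      by (cases z) (simp add: power_add prod.distrib)
    show ?case
    proof (intro exI allI)
      fix x
      have "f x * g x = (\<Sum>z\<in>?S. a (fst z) * b (snd z) * mono_val N (?p z) x)"
        unfolding f g sum_product sum.cartesian_product
      proof (rule sum.cong[OF refl])
        fix z assume "z \<in> ?S"
        obtain \<alpha> \<beta> where z: "z = (\<alpha>, \<beta>)" by (cases z)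
        show "(case z of (\<alpha>, \<beta>) \<Rightarrow> a \<alpha> * mono_val N \<alpha> x * (b \<beta> * mono_val N \<beta> x)) =
          a (fst z) * b (snd z) * mono_val N (?p z) x"
          by (subst mono) (simp add: z)
      qed
      \<comment> \<open>The coefficient of \<open>\<gamma>\<close> collects all pairs of exponents
        with sum \<open>\<gamma>\<close>.\<close>
      also have "\<dots> = (\<Sum>\<gamma>\<in>?T. \<Sum>z\<in>{z\<in>?S. ?p z = \<gamma>}. a (fst z) * b (snd z) * mono_val N (?p z) x)"
        by (rule sum.group[symmetric, OF fin p])
      also have "\<dots> = (\<Sum>\<gamma>\<in>?T. (\<Sum>z\<in>{z\<in>?S. ?p z = \<gamma>}. a (fst z) * b (snd z)) * mono_val N \<gamma> x)"
        unfolding sum_distrib_right by (intro sum.cong refl) auto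
      finally show "f x * g x =
        (\<Sum>\<gamma>\<in>?T. (\<Sum>z\<in>{z\<in>?S. ?p z = \<gamma>}. a (fst z) * b (snd z)) * mono_val N \<gamma> x)" .
    qed
  qed
qed

text \<open>There are \<open>Suc D ^ N\<close> monomials, so the coefficient vectors of more
  functions than that are dependent.\<close>

lemma bpoly_linear_dependence:
  assumes "finite I" "\<And>i. i \<in> I \<Longrightarrow> bpoly N D (F i)" "Suc D ^ N < card I"
  shows "\<exists>c. (\<exists>i\<in>I. c i \<noteq> 0) \<and> (\<forall>x. (\<Sum>i\<in>I. c i * F i x) = 0)"
proof -
  have "\<forall>i\<in>I. \<exists>a. \<forall>x. F i x = (\<Sum>\<alpha>\<in>expos N D. a \<alpha> * mono_val N \<alpha> x)"
    using assms(2) bpoly_expansion by blast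
  then obtain a where a: "\<And>i x. i \<in> I \<Longrightarrow> F i x = (\<Sum>\<alpha>\<in>expos N D. a i \<alpha> * mono_val N \<alpha> x)"
    by metis
  obtain c where c: "\<exists>i\<in>I. c i \<noteq> 0" "\<forall>\<alpha>\<in>expos N D. (\<Sum>i\<in>I. c i * a i \<alpha>) = 0"
    using homogeneous_system_nontrivial_solution[of "expos N D" I "\<lambda>\<alpha> i. a i \<alpha>"] assms
    by (auto simp: card_expos finite_PiE)
  have "(\<Sum>i\<in>I. c i * F i x) = 0" for x
  proof -
    have "(\<Sum>i\<in>I. c i * F i x) = (\<Sum>i\<in>I. \<Sum>\<alpha>\<in>expos N D. c i * a i \<alpha> * mono_val N \<alpha> x)"
      by (intro sum.cong) (auto simp: a sum_distrib_left mult_ac)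
    also have "\<dots> = (\<Sum>\<alpha>\<in>expos N D. (\<Sum>i\<in>I. c i * a i \<alpha>) * mono_val N \<alpha> x)"
      by (subst sum.swap) (simp add: sum_distrib_right)
    finally show ?thesis using c(2) by simp
  qed
  with c(1) show ?thesis by blast
qed

section \<open>The number of sign vectors\<close>

abbreviation cube :: "nat \<Rightarrow> real \<Rightarrow> (nat \<Rightarrow> real) set" where
  "cube N R \<equiv> {x. (\<forall>i<N. \<bar>x i\<bar> \<le> R) \<and> (\<forall>i\<ge>N. x i = 0)}"

text \<open>Points are functions on all of \<open>nat\<close> in the product topology; as the
  coordinates from \<open>N\<close> on are pinned to 0, the cube is a product of compact sets and
  Tychonoff's theorem applies.\<close>

lemma compact_cube: "compact (cube N R)"
proof -
  have eq: "cube N R = PiE UNIV (\<lambda>i. if i < N then {-R..R} else {0})"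
  proof (intro set_eqI iffI)
    fix x :: "nat \<Rightarrow> real"
    assume x: "x \<in> PiE UNIV (\<lambda>i. if i < N then {-R..R} else {0})"
    have mem: "x i \<in> (if i < N then {-R..R} else {0})" for i using x by (auto simp: PiE_def Pi_def)
    then have "\<bar>x i\<bar> \<le> R" if "i < N" for i
      using mem[of i] that by (simp add: abs_le_iff minus_le_iff)
    moreover have "x i = 0" if "i \<ge> N" for i
      using mem[of i] that by simp
    ultimately show "x \<in> cube N R" by simp
  qed (auto simp: PiE_def Pi_def abs_le_iff minus_le_iff)
  have "compactin (product_topology (\<lambda>i. euclidean) UNIV)
      (PiE UNIV (\<lambda>i::nat. if i < N then {-R..R} else {0::real}))"
    unfolding compactin_PiE by (auto simp: compactin_euclidean_iff)
  then show ?thesis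
    unfolding eq by (simp add: euclidean_product_topology compactin_euclidean_iff)
qed

text \<open>The maximum of \<open>G x - \<Sum>i. y i * x i\<close> over the closed sign cell of \<open>w\<close> is attained in the open
  cell, because \<open>G\<close> vanishes on its boundary and \<open>y\<close> is small.\<close>

lemma gradient_onto_small_vectors:
  fixes f :: "'i \<Rightarrow> (nat \<Rightarrow> real) \<Rightarrow> real"
  assumes fin: "finite I" and f: "\<And>i. i \<in> I \<Longrightarrow> bpoly N D (f i)"
    and G: "\<And>x. G x = ((\<Prod>i<N. R^2 - (x i)^2) * (\<Prod>i\<in>I. f i x))^2"
    and G': "\<And>i x. i < N \<Longrightarrow> ((\<lambda>t. G (x(i := t))) has_real_derivative G' i x) (at (x i))"
    and w: "w \<in> cube N R" "2 * \<delta> \<le> G w" "\<delta> > 0"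
    and y: "\<And>i. i < N \<Longrightarrow> 0 < y i \<and> y i < \<eta>" and \<eta>: "2 * N * R * \<eta> \<le> \<delta>"
  shows "\<exists>z\<in>cube N R. G z \<ge> \<delta> \<and> (\<forall>i\<in>I. sgn (f i z) = sgn (f i w)) \<and> (\<forall>i<N. G' i z = y i)"
proof -
  define C where "C = cube N R \<inter> {x. \<forall>i\<in>I. 0 \<le> f i w * f i x}"
  define \<Phi> where "\<Phi> x = G x - (\<Sum>i<N. y i * x i)" for x
  have coord: "continuous_on S (\<lambda>x. x i)" for i and S :: "(nat \<Rightarrow> real) set"
    by (intro continuous_on_subset[OF continuous_on_product_coordinates]) simp
  have contf: "continuous_on S (f i)" if "i \<in> I" for i S
    using f[OF that] by (rule continuous_on_bpoly)
  have contG: "continuous_on S G" for S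
  proof -
    have "continuous_on S (\<lambda>x. ((\<Prod>i<N. R^2 - (x i)^2) * (\<Prod>i\<in>I. f i x))^2)"
      by (intro continuous_intros coord contf)
    then show ?thesis using G by presburger
  qed
  have closed: "closed {x. \<forall>i\<in>I. 0 \<le> f i w * f i x}"
  proof -
    have "closed (\<Inter>i\<in>I. {x. 0 \<le> f i w * f i x})"
      by (intro closed_INT ballI closed_Collect_le continuous_intros contf)
    moreover have "{x. \<forall>i\<in>I. 0 \<le> f i w * f i x} = (\<Inter>i\<in>I. {x. 0 \<le> f i w * f i x})" by auto
    ultimately show ?thesis by simp
  qed
  have "compact C" unfolding C_def using compact_cube closed by (rule compact_Int_closed)
  moreover have wC: "w \<in> C" using w(1) by (auto simp: C_def)
  moreover have "continuous_on C \<Phi>"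
    unfolding \<Phi>_def by (intro continuous_intros contG coord)
  ultimately obtain z where z: "z \<in> C" "\<And>x. x \<in> C \<Longrightarrow> \<Phi> x \<le> \<Phi> z"
    using continuous_attains_sup[of C \<Phi>] by blast
  have zb: "z \<in> cube N R" using z(1) by (auto simp: C_def)
  \<comment> \<open>Within the cube the linear term of \<open>\<Phi>\<close> varies by at most
    \<open>\<delta>\<close>, so maximality of \<open>z\<close> and
    \<open>2 * \<delta> \<le> G w\<close> leave \<open>G z \<ge> \<delta>\<close>. Hence
    \<open>z\<close> avoids the zeros of \<open>G\<close>.\<close>
  have "(\<Sum>i<N. y i * (w i - z i)) \<le> (\<Sum>i<N. \<eta> * (2 * R))"
  proof (rule sum_mono)
    fix i assume "i \<in> {..<N}"
    then have i: "\<bar>w i\<bar> \<le> R" "\<bar>z i\<bar> \<le> R" "0 < y i" "y i < \<eta>" using w(1) zb y by auto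
    have "y i * (w i - z i) \<le> y i * (2 * R)" using i by (intro mult_left_mono) auto
    also have "\<dots> \<le> \<eta> * (2 * R)" using i by (intro mult_right_mono) auto
    finally show "y i * (w i - z i) \<le> \<eta> * (2 * R)" .
  qed
  then have "(\<Sum>i<N. y i * w i) - (\<Sum>i<N. y i * z i) \<le> \<delta>"
    using \<eta> by (simp add: sum_subtractf right_diff_distrib algebra_simps)
  then have Gz: "G z \<ge> \<delta>" using z(2)[OF wC] w(2) unfolding \<Phi>_def by linarith
  then have "G z \<noteq> 0" using w(3) by simp
  then have ne: "(\<Prod>i<N. R^2 - (z i)^2) \<noteq> 0" "(\<Prod>i\<in>I. f i z) \<noteq> 0" unfolding G by auto
  have zR: "\<bar>z i\<bar> < R" if "i < N" for i
  proof -
    have "R^2 - (z i)^2 \<noteq> 0" using ne(1) that by auto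
    then have "\<bar>z i\<bar> \<noteq> R" by auto
    then show ?thesis using zb that by force
  qed
  have "w \<in> cube N R" "G w \<noteq> 0" using w by auto
  then have fw: "f i w \<noteq> 0" if "i \<in> I" for i using that fin unfolding G by auto
  have fz: "f i z \<noteq> 0" if "i \<in> I" for i using ne(2) that fin by auto
  have pos: "0 < f i w * f i z" if "i \<in> I" for i
    using z(1) fw[OF that] fz[OF that] that by (auto simp: C_def less_le)
  have "G' i z = y i" if i: "i < N" for i
  proof -
    have "((\<lambda>t. \<Phi> (z(i := t))) has_real_derivative G' i z - y i) (at (z i))"
    proof -
      have "(\<Sum>j<N. y j * (z(i := t)) j) = y i * t + (\<Sum>j\<in>{..<N} - {i}. y j * z j)" for t
        using i by (subst sum.remove[of _ i]) auto
      then have eq: "\<Phi> (z(i := t)) = G (z(i := t)) - (y i * t + (\<Sum>j\<in>{..<N} - {i}. y j * z j))" for t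
        unfolding \<Phi>_def by simp
      show ?thesis unfolding eq
        by (rule derivative_eq_intros G'[OF i] refl)+ simp
    qed
    \<comment> \<open>The strict inequalities at \<open>z\<close> persist nearby, so changing one
      coordinate slightly stays in \<open>C\<close>, and \<open>z i\<close> is a local maximum of
      \<open>\<Phi>\<close> along that coordinate.\<close>
    moreover have "\<forall>\<^sub>F t in nhds (z i). z(i := t) \<in> C"
    proof -
      have "\<forall>\<^sub>F t in nhds (z i). 0 < f j w * f j (z(i := t))" if j: "j \<in> I" for j
      proof -
        define h where "h t = f j w * f j (z(i := t))" for t
        obtain f' where "((\<lambda>t. f j (z(i := t))) has_real_derivative f' z) (at (z i))"
          using bpoly_partial_derivative[OF f[OF j]] by blast
        then have "isCont h (z i)"
          unfolding h_def by (intro continuous_intros DERIV_isCont)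
        then have "(h \<longlongrightarrow> h (z i)) (nhds (z i))"
          unfolding isCont_def tendsto_at_iff_tendsto_nhds .
        from order_tendstoD(1)[OF this, of 0] show ?thesis using pos[OF j] by (simp add: h_def)
      qed
      then have "\<forall>\<^sub>F t in nhds (z i). \<forall>j\<in>I. 0 < f j w * f j (z(i := t))"
        using fin by (simp add: eventually_ball_finite_distrib)
      moreover have "\<forall>\<^sub>F t in nhds (z i). t \<in> {-R<..<R}"
        by (rule eventually_nhds_in_open) (use zR[OF i] in auto)
      ultimately show ?thesis
      proof eventually_elim
        case (elim t)
        then show ?case using zb i by (auto simp: C_def less_imp_le abs_le_iff)
      qed
    qed
    then obtain d where d: "d > 0" "\<And>t. dist t (z i) < d \<Longrightarrow> z(i := t) \<in> C"
      unfolding eventually_nhds_metric by blast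
    have "\<forall>t. \<bar>z i - t\<bar> < d \<longrightarrow> \<Phi> (z(i := t)) \<le> \<Phi> (z(i := z i))"
      using d(2) z(2) by (simp add: dist_real_def abs_minus_commute)
    ultimately have "G' i z - y i = 0"
      using d(1) DERIV_local_max[of "\<lambda>t. \<Phi> (z(i := t))" _ "z i" d] by blast
    then show ?thesis by simp
  qed
  moreover have "sgn (f i z) = sgn (f i w)" if "i \<in> I" for i
    using pos[OF that] by (auto simp: zero_less_mult_iff)
  ultimately show ?thesis using Gz zb by blast
qed

text \<open>No \<open>f i\<close> vanishes on \<open>S\<close>, so a function with distinct integer
  values on the cells of \<open>W\<close> is continuous there. Stone-Weierstrass replaces it by a
  polynomial with error below 1/2, which still tells these cells apart. Its degree \<open>H\<close>
  is not controlled.\<close>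

lemma bpoly_separating_sign_vectors:
  fixes f :: "'i \<Rightarrow> (nat \<Rightarrow> real) \<Rightarrow> real"
  assumes I: "finite I" "\<And>i. i \<in> I \<Longrightarrow> bpoly N D (f i)"
    and S: "compact S" "S \<subseteq> cube N R" "\<And>x i. x \<in> S \<Longrightarrow> i \<in> I \<Longrightarrow> f i x \<noteq> 0"
    and W: "finite W" "\<And>w w'. w \<in> W \<Longrightarrow> w' \<in> W \<Longrightarrow> \<forall>i\<in>I. sgn (f i w) = sgn (f i w') \<Longrightarrow> w = w'"
      "\<And>w i. w \<in> W \<Longrightarrow> i \<in> I \<Longrightarrow> f i w \<noteq> 0"
  shows "\<exists>h H. bpoly N H h \<and> (\<forall>w\<in>W. \<forall>w'\<in>W. \<forall>z\<in>S. \<forall>z'\<in>S.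
    (\<forall>i\<in>I. sgn (f i z) = sgn (f i w)) \<and> (\<forall>i\<in>I. sgn (f i z') = sgn (f i w')) \<and> h z = h z' \<longrightarrow> w = w')"
proof -
  obtain idx :: "(nat \<Rightarrow> real) \<Rightarrow> nat" where idx: "inj_on idx W"
    using finite_imp_inj_to_nat_seg[OF W(1)] by blast
  \<comment> \<open>The product is an indicator: 1 on the cell of \<open>w\<close>, 0 on the cell of
    every other point of \<open>W\<close>.\<close>
  define code where
    "code x = (\<Sum>w\<in>W. real (idx w) * (\<Prod>i\<in>I. (1 + sgn (f i x) * sgn (f i w)) / 2))" for x
  have code: "code z = idx w" if w: "w \<in> W" and z: "\<forall>i\<in>I. sgn (f i z) = sgn (f i w)" for z w
  proof -
    have "(\<Prod>i\<in>I. (1 + sgn (f i z) * sgn (f i w')) / 2) = (if w' = w then 1 else 0)"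
      if w': "w' \<in> W" for w'
    proof (cases "w' = w")
      case True
      have "(\<Prod>i\<in>I. (1 + sgn (f i z) * sgn (f i w)) / 2) = 1"
        by (rule prod.neutral) (use z W(3)[OF w] in \<open>auto simp: sgn_if\<close>)
      then show ?thesis using True by simp
    next
      case False
      then obtain i where i: "i \<in> I" "sgn (f i w) \<noteq> sgn (f i w')" using W(2)[OF w w'] by blast
      then have "1 + sgn (f i z) * sgn (f i w') = 0"
        using z W(3)[OF w] W(3)[OF w'] by (auto simp: sgn_if split: if_splits)
      then show ?thesis using i(1) I(1) False by (auto simp: prod_zero_iff)
    qed
    then have "code z = (\<Sum>w'\<in>W. if w' = w then real (idx w') else 0)"
      unfolding code_def by (intro sum.cong) auto
    then show ?thesis using w W(1) by simp
  qed
  have cont: "continuous_on S code"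
    unfolding code_def
    by (intro continuous_intros continuous_on_bpoly[OF I(2)]) (use S(3) in auto)
  have sep: "\<exists>f. (\<exists>H. bpoly N H f) \<and> f x \<noteq> f y" if "x \<in> S" "y \<in> S" "x \<noteq> y" for x y
  proof -
    obtain i where "x i \<noteq> y i" using \<open>x \<noteq> y\<close> by auto
    moreover have "i < N"
    proof (rule ccontr)
      assume "\<not> i < N"
      then have "x i = 0" "y i = 0" using that S(2) by auto
      then show False using \<open>x i \<noteq> y i\<close> by simp
    qed
    ultimately show ?thesis using bpoly_coord by blast
  qed
  have add: "\<exists>H. bpoly N H (\<lambda>x. f x + g x)" if "bpoly N H f" "bpoly N H' g" for f g H H'
    using bpoly_add[OF bpoly_mono[OF that(1), of "H + H'"] bpoly_mono[OF that(2), of "H + H'"]] by auto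
  have "\<exists>h. (\<exists>H. bpoly N H h) \<and> (\<forall>x\<in>S. \<bar>code x - h x\<bar> < 1 / 2)"
  proof (rule Stone_Weierstrass_HOL[OF S(1)])
    show "\<exists>H. bpoly N H (\<lambda>x. c)" for c using bpoly_const by blast
    show "\<exists>H. bpoly N H f \<Longrightarrow> continuous_on S f" for f using continuous_on_bpoly by blast
    show "(\<exists>H. bpoly N H f) \<and> (\<exists>H. bpoly N H g) \<Longrightarrow> \<exists>H. bpoly N H (\<lambda>x. f x + g x)" for f g
      using add by blast
    show "(\<exists>H. bpoly N H f) \<and> (\<exists>H. bpoly N H g) \<Longrightarrow> \<exists>H. bpoly N H (\<lambda>x. f x * g x)" for f g
      using bpoly_mult by blast
  qed (use cont sep in auto)
  then obtain h where h: "\<exists>H. bpoly N H h" "\<And>x. x \<in> S \<Longrightarrow> \<bar>code x - h x\<bar> < 1 / 2"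
    by blast
  have "w = w'" if "w \<in> W" "w' \<in> W" "z \<in> S" "z' \<in> S" "\<forall>i\<in>I. sgn (f i z) = sgn (f i w)"
    "\<forall>i\<in>I. sgn (f i z') = sgn (f i w')" "h z = h z'" for w w' z z'
  proof -
    have "\<bar>real (idx w) - real (idx w')\<bar> < 1"
      using h(2)[OF that(3)] h(2)[OF that(4)] code[OF that(1,5)] code[OF that(2,6)] that(7) by linarith
    then have "idx w = idx w'" by linarith
    then show ?thesis using idx that by (auto dest: inj_onD)
  qed
  then show ?thesis using h(1) by blast
qed

text \<open>With \<open>K = card W\<close>, there are \<open>K * Suc T ^ N\<close> products in a
  space of dimension at most \<open>Suc (T + N * (T * E)) ^ N\<close>. For \<open>T = K * H\<close>
  the powers of \<open>Suc T\<close> cancel, and with them the unknown degree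
  \<open>H\<close>.\<close>

lemma sign_vector_cells_bound:
  fixes f :: "'i \<Rightarrow> (nat \<Rightarrow> real) \<Rightarrow> real"
  assumes I: "finite I" "\<And>i. i \<in> I \<Longrightarrow> bpoly N D (f i)"
    and W: "finite W" "\<And>w i. w \<in> W \<Longrightarrow> i \<ge> N \<Longrightarrow> w i = 0"
      "\<And>w w'. w \<in> W \<Longrightarrow> w' \<in> W \<Longrightarrow> \<forall>i\<in>I. sgn (f i w) = sgn (f i w') \<Longrightarrow> w = w'"
      "\<And>w i. w \<in> W \<Longrightarrow> i \<in> I \<Longrightarrow> f i w \<noteq> 0"
  shows "card W \<le> Suc (N * (2 * (N * 2 + card I * D))) ^ N"
proof (rule ccontr)
  \<comment> \<open>Degree of the square of \<open>N\<close> quadratic factors times all the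
    \<open>f i\<close>.\<close>
  define E where "E = 2 * (N * 2 + card I * D)"
  assume "\<not> ?thesis"
  then have big: "Suc (N * E) ^ N < card W" by (simp add: E_def)
  \<comment> \<open>\<open>R\<close> exceeds all coordinates of \<open>W\<close> in absolute value,
    so the cut-off factors of \<open>G\<close> do not vanish on \<open>W\<close>.\<close>
  define R where "R = 1 + (\<Sum>w\<in>W. \<Sum>i<N. \<bar>w i\<bar>)"
  have R: "\<bar>w i\<bar> < R" if "w \<in> W" "i < N" for w i
  proof -
    have "\<bar>w i\<bar> \<le> (\<Sum>i<N. \<bar>w i\<bar>)" using that by (intro member_le_sum) auto
    also have "\<dots> \<le> (\<Sum>w\<in>W. \<Sum>i<N. \<bar>w i\<bar>)"
      using that W(1) by (intro member_le_sum[where f = "\<lambda>w. \<Sum>i<N. \<bar>w i\<bar>"]) (auto intro: sum_nonneg)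
    finally show ?thesis by (simp add: R_def)
  qed
  have "R \<ge> 1" by (simp add: R_def sum_nonneg)
  have Wcube: "w \<in> cube N R" if "w \<in> W" for w using R[OF that] W(2)[OF that] by (auto intro: less_imp_le)
  define G where "G x = ((\<Prod>i<N. R^2 - (x i)^2) * (\<Prod>i\<in>I. f i x))^2" for x
  have bG: "bpoly N E G"
  proof -
    have "bpoly N 2 (\<lambda>x. R^2 - (x i)^2)" if "i < N" for i
      using bpoly_diff[OF bpoly_const bpoly_power[OF bpoly_coord[OF that, of 0], of 2]] by simp
    then have "bpoly N (N * 2) (\<lambda>x. \<Prod>i<N. R^2 - (x i)^2)"
      using bpoly_prod[of "{..<N}" N 2 "\<lambda>i x. R^2 - (x i)^2"] by simp
    then show ?thesis
      unfolding G_def E_def by (intro bpoly_power bpoly_mult bpoly_prod I)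
  qed
  have Gpos: "G w > 0" if w: "w \<in> W" for w
  proof -
    have "R^2 - (w i)^2 \<noteq> 0" if "i < N" for i
      using R[OF w that] power2_strict_mono[of "w i" R] by (auto simp: abs_less_iff)
    then show ?thesis unfolding G_def using W(4)[OF w] I(1) by simp
  qed
  have "\<exists>\<delta>>0. \<forall>w\<in>W. 2 * \<delta> \<le> G w"
  proof (cases "W = {}")
    case False
    then show ?thesis
      using Gpos W(1) by (intro exI[of _ "Min (G ` W) / 2"]) auto
  qed (auto intro: exI[of _ 1])
  then obtain \<delta> where \<delta>: "\<delta> > 0" "\<And>w. w \<in> W \<Longrightarrow> 2 * \<delta> \<le> G w" by blast
  have "\<forall>i. \<exists>g'. bpoly N E g' \<and> (\<forall>x. ((\<lambda>t. G (x(i := t))) has_real_derivative g' x) (at (x i)))"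
    using bpoly_partial_derivative[OF bG] by blast
  then obtain G' where G': "\<And>i. bpoly N E (G' i)"
    "\<And>i x. ((\<lambda>t. G (x(i := t))) has_real_derivative G' i x) (at (x i))"
    by metis
  \<comment> \<open>The \<open>+ 1\<close> keeps the denominator nonzero if \<open>N\<close> is
    0.\<close>
  define \<eta> where "\<eta> = \<delta> / (2 * N * R + 1)"
  have "2 * N * R \<ge> 0" using \<open>R \<ge> 1\<close> by simp
  then have \<eta>: "\<eta> > 0" "2 * N * R * \<eta> \<le> \<delta>"
    using \<delta>(1) by (auto simp: \<eta>_def field_simps add_pos_nonneg)
  define S where "S = cube N R \<inter> {x. \<delta> \<le> G x}"
  have "closed {x. \<delta> \<le> G x}"
    by (intro closed_Collect_le continuous_on_bpoly[OF bG] continuous_intros)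
  with compact_cube have "compact S" unfolding S_def by (rule compact_Int_closed)
  have fS: "f i x \<noteq> 0" if "x \<in> S" "i \<in> I" for x i
  proof
    assume "f i x = 0"
    with that(2) I(1) have "(\<Prod>i\<in>I. f i x) = 0" by auto
    with that(1) \<delta>(1) show False by (simp add: S_def G_def)
  qed
  have sub: "S \<subseteq> cube N R" by (auto simp: S_def)
  have "\<exists>h H. bpoly N H h \<and> (\<forall>w\<in>W. \<forall>w'\<in>W. \<forall>z\<in>S. \<forall>z'\<in>S.
    (\<forall>i\<in>I. sgn (f i z) = sgn (f i w)) \<and> (\<forall>i\<in>I. sgn (f i z') = sgn (f i w')) \<and> h z = h z' \<longrightarrow> w = w')"
    by (rule bpoly_separating_sign_vectors[OF I(1) _ \<open>compact S\<close> sub _ W(1)]) (fact I(2) fS W(3,4))+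
  then obtain h H where h: "bpoly N H h" and sep:
    "\<And>w w' z z'. \<lbrakk>w \<in> W; w' \<in> W; z \<in> S; z' \<in> S; \<forall>i\<in>I. sgn (f i z) = sgn (f i w);
      \<forall>i\<in>I. sgn (f i z') = sgn (f i w'); h z = h z'\<rbrakk> \<Longrightarrow> w = w'"
    by blast
  have cell: "\<exists>z\<in>S. (\<forall>i\<in>I. sgn (f i z) = sgn (f i w)) \<and> (\<forall>i<N. G' i z = y i)"
    if "w \<in> W" "\<And>i. i < N \<Longrightarrow> 0 < y i \<and> y i < \<eta>" for w y
  proof -
    have "\<exists>z\<in>cube N R. G z \<ge> \<delta> \<and> (\<forall>i\<in>I. sgn (f i z) = sgn (f i w)) \<and> (\<forall>i<N. G' i z = y i)"
      by (rule gradient_onto_small_vectors[where D = D and G = G and \<eta> = \<eta>])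
        (rule G'(2) | fact I G_def Wcube[OF that(1)] \<delta>(1) \<delta>(2)[OF that(1)] that(2) \<eta>(2))+
    then show ?thesis by (auto simp: S_def)
  qed
  define K where "K = card W"
  \<comment> \<open>\<open>T\<close> bounds the degree of every \<open>h ^ a\<close> with
    \<open>a < K\<close>.\<close>
  define T where "T = K * H"
  define J where "J = {..<K} \<times> expos N T"
  define F where "F j x = h x ^ fst j * mono_val N (snd j) (\<lambda>i. G' i x)" for j x
  have finJ: "finite J" by (auto simp: J_def intro: finite_PiE)
  have bF: "bpoly N (T + N * (T * E)) (F j)" if "j \<in> J" for j
  proof -
    have "bpoly N (card {..<N} * (T * E)) (\<lambda>x. mono_val N (snd j) (\<lambda>i. G' i x))"
    proof (rule bpoly_prod)
      fix i assume "i \<in> {..<N}"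
      then have "snd j i \<le> T" using that by (auto simp: J_def PiE_def Pi_def)
      then show "bpoly N (T * E) (\<lambda>x. G' i x ^ snd j i)"
        using bpoly_mono[OF bpoly_power[OF G'(1)]] by (metis mult_le_mono1)
    qed simp
    then have "bpoly N (N * (T * E)) (\<lambda>x. mono_val N (snd j) (\<lambda>i. G' i x))" by simp
    moreover have "bpoly N T (\<lambda>x. h x ^ fst j)"
    proof -
      have "fst j < K" using that by (simp add: J_def mem_Times_iff)
      then have "fst j * H \<le> T" unfolding T_def by (intro mult_le_mono1) simp
      with bpoly_power[OF h, of "fst j"] show ?thesis by (rule bpoly_mono)
    qed
    ultimately have "bpoly N (T + N * (T * E)) (\<lambda>x. h x ^ fst j * mono_val N (snd j) (\<lambda>i. G' i x))"
      using bpoly_mult[of N T "\<lambda>x. h x ^ fst j"] by blast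
    then show ?thesis unfolding F_def .
  qed
  have "Suc (T + N * (T * E)) ^ N \<le> (Suc T * Suc (N * E)) ^ N"
    by (intro power_mono) (auto simp: algebra_simps)
  also have "\<dots> < K * Suc T ^ N"
    unfolding power_mult_distrib K_def mult.commute[of "Suc T ^ N"] using big
    by (intro mult_strict_right_mono) simp_all
  also have "\<dots> = card J" by (simp add: J_def card_cartesian_product card_expos)
  finally have "Suc (T + N * (T * E)) ^ N < card J" .
  with finJ bF have "\<exists>c. (\<exists>j\<in>J. c j \<noteq> 0) \<and> (\<forall>x. (\<Sum>j\<in>J. c j * F j x) = 0)"
    by (rule bpoly_linear_dependence[where F = F])
  then obtain c where c: "\<exists>j\<in>J. c j \<noteq> 0" "\<And>x. (\<Sum>j\<in>J. c j * F j x) = 0"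
    by blast
  \<comment> \<open>When the partial derivatives take the values \<open>y\<close>, the dependence
    becomes a polynomial in the value of \<open>h\<close> with coefficients
    \<open>P a y\<close>.\<close>
  define P where "P a y = (\<Sum>\<alpha>\<in>expos N T. c (a, \<alpha>) * mono_val N \<alpha> y)" for a y
  have P: "P a y = 0" if a: "a < K" and y: "\<forall>i<N. 0 < y i \<and> y i < \<eta>" for a y
  proof -
    \<comment> \<open>For a single \<open>y\<close> every cell contains a point with gradient
      \<open>y\<close>. At these points \<open>h\<close> takes \<open>K\<close> distinct values, all
      roots of a polynomial of degree below \<open>K\<close>.\<close>
    have "\<forall>w\<in>W. \<exists>z\<in>S. (\<forall>i\<in>I. sgn (f i z) = sgn (f i w)) \<and> (\<forall>i<N. G' i z = y i)"
      using cell y by blast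
    then obtain z where z: "\<And>w. w \<in> W \<Longrightarrow> z w \<in> S"
      "\<And>w. w \<in> W \<Longrightarrow> \<forall>i\<in>I. sgn (f i (z w)) = sgn (f i w)"
      "\<And>w i. w \<in> W \<Longrightarrow> i < N \<Longrightarrow> G' i (z w) = y i"
      by metis
    have "inj_on (\<lambda>w. h (z w)) W"
      by (intro inj_onI) (use sep z in blast)
    then have card: "card ((\<lambda>w. h (z w)) ` W) = K" by (simp add: card_image K_def)
    show ?thesis
    proof (rule real_poly_coeffs_zero[where b = "\<lambda>a. P a y" and S = "(\<lambda>w. h (z w)) ` W" and K = K])
      fix t assume "t \<in> (\<lambda>w. h (z w)) ` W"
      then obtain w where w: "w \<in> W" "t = h (z w)" by blast
      have m: "mono_val N \<alpha> (\<lambda>i. G' i (z w)) = mono_val N \<alpha> y" for \<alpha>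
        using z(3)[OF w(1)] by (intro prod.cong) auto
      have "(\<Sum>a<K. P a y * t ^ a) = (\<Sum>a<K. \<Sum>\<alpha>\<in>expos N T. c (a, \<alpha>) * F (a, \<alpha>) (z w))"
        unfolding P_def F_def sum_distrib_right w(2) fst_conv snd_conv m
        by (intro sum.cong refl) (simp only: mult_ac)
      also have "\<dots> = (\<Sum>j\<in>J. c j * F j (z w))"
        unfolding J_def sum.cartesian_product by (intro sum.cong refl) auto
      finally show "(\<Sum>a<K. P a y * t ^ a) = 0" using c(2) by simp
    qed (use a card in auto)
  qed
  have "c (a, \<alpha>) = 0" if "a < K" "\<alpha> \<in> expos N T" for a \<alpha>
    by (rule poly_vanishing_on_box[OF \<eta>(1), of N "\<lambda>\<alpha>. c (a, \<alpha>)" T])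
      (use P[OF that(1)] that(2) in \<open>auto simp: P_def\<close>)
  with c(1) show False by (auto simp: J_def)
qed

text \<open>Zero values are removed by doubling: for small \<open>\<epsilon>\<close>, the sign of \<open>f\<close> at finitely many points is
  determined by the nonzero signs of \<open>f - \<epsilon>\<close> and \<open>f + \<epsilon>\<close>.\<close>

lemma card_sign_vectors_le:
  fixes f :: "'i \<Rightarrow> (nat \<Rightarrow> real) \<Rightarrow> real"
  assumes I: "finite I" "\<And>i. i \<in> I \<Longrightarrow> bpoly N D (f i)"
    and X: "finite X" "\<And>x i. x \<in> X \<Longrightarrow> i \<ge> N \<Longrightarrow> x i = 0"
  shows "card ((\<lambda>x. \<lambda>i\<in>I. sgn (f i x)) ` X) \<le> Suc (N * (2 * (N * 2 + 2 * card I * D))) ^ N"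
proof -
  let ?s = "\<lambda>x. \<lambda>i\<in>I. sgn (f i x)"
  \<comment> \<open>One representative in \<open>X\<close> for each sign vector.\<close>
  obtain W where W: "W \<subseteq> X" "inj_on ?s W" "?s ` X = ?s ` W"
    using subset_image_inj[of "?s ` X" ?s X] by auto
  have finW: "finite W" using W(1) X(1) by (rule finite_subset)
  \<comment> \<open>The element 1 keeps the minimum defined if all values are 0;
    \<open>\<epsilon>\<close> lies below every nonzero absolute value.\<close>
  define V where "V = insert 1 ((\<lambda>(w, i). \<bar>f i w\<bar>) ` (W \<times> I) - {0})"
  define \<epsilon> where "\<epsilon> = Min V / 2"
  have V: "finite V" "V \<noteq> {}" "\<forall>v\<in>V. v > 0" using finW I(1) by (auto simp: V_def)
  have pos: "\<epsilon> > 0" using V by (auto simp: \<epsilon>_def)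
  have small: "\<bar>f i w\<bar> > \<epsilon>" if "w \<in> W" "i \<in> I" "f i w \<noteq> 0" for w i
  proof -
    have "\<bar>f i w\<bar> \<in> V" using that by (force simp: V_def)
    then have "Min V \<le> \<bar>f i w\<bar>" using V(1) by simp
    then show ?thesis using pos by (simp add: \<epsilon>_def)
  qed
  define g where "g j x = (if snd j then f (fst j) x + \<epsilon> else f (fst j) x - \<epsilon>)" for j x
  have ne: "g j w \<noteq> 0" if "w \<in> W" "j \<in> I \<times> UNIV" for w j
    using small[OF that(1), of "fst j"] that(2) pos by (cases "f (fst j) w = 0") (auto simp: g_def)
  have inj: "w = w'" if w: "w \<in> W" "w' \<in> W"
    and sg: "\<forall>j\<in>I \<times> UNIV. sgn (g j w) = sgn (g j w')" for w w'
  proof -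
    have "sgn (f i w) = sgn (f i w')" if i: "i \<in> I" for i
    proof -
      have eq: "sgn (f i w + \<epsilon>) = sgn (f i w' + \<epsilon>)" "sgn (f i w - \<epsilon>) = sgn (f i w' - \<epsilon>)"
        using sg[rule_format, of "(i, True)"] sg[rule_format, of "(i, False)"] i by (auto simp: g_def)
      have "f i w = 0 \<or> \<bar>f i w\<bar> > \<epsilon>" "f i w' = 0 \<or> \<bar>f i w'\<bar> > \<epsilon>"
        using small[OF w(1) i] small[OF w(2) i] by blast+
      then show ?thesis using eq pos by (auto simp: sgn_if split: if_splits)
    qed
    then have "?s w = ?s w'" by (intro restrict_ext) auto
    then show ?thesis using W(2) w by (auto dest: inj_onD)
  qed
  have "card (?s ` X) = card W" unfolding W(3) using W(2) by (rule card_image)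
  also have "\<dots> \<le> Suc (N * (2 * (N * 2 + card (I \<times> (UNIV :: bool set)) * D))) ^ N"
  proof (rule sign_vector_cells_bound[of "I \<times> UNIV" N D g W])
    fix j assume "j \<in> I \<times> (UNIV :: bool set)"
    then have "bpoly N D (f (fst j))" using I(2) by auto
    then have "bpoly N D (\<lambda>x. f (fst j) x + \<epsilon>)" "bpoly N D (\<lambda>x. f (fst j) x - \<epsilon>)"
      by (auto intro: bpoly_add bpoly_diff bpoly_const)
    then show "bpoly N D (g j)" unfolding g_def by (cases "snd j") simp_all
  next
    show "finite (I \<times> (UNIV :: bool set))" using I(1) by simp
    show "w i = 0" if "w \<in> W" "i \<ge> N" for w i using X(2) W(1) that by blast
  qed (fact finW inj ne)+
  finally show ?thesis by (simp add: card_cartesian_product mult_ac)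
qed

section \<open>Reconstructing a drawing from its slopes\<close>

text \<open>The determinant of two vectors, zero exactly if they are linearly dependent.\<close>

definition cross :: "real \<times> real \<Rightarrow> real \<times> real \<Rightarrow> real" where
  "cross a b = fst a * snd b - snd a * fst b"

lemma cross_scaleR: "cross (s *\<^sub>R a) b = s * cross a b" "cross a (s *\<^sub>R b) = s * cross a b"
  by (simp_all add: cross_def algebra_simps)

lemma cross_add_left: "cross (a + a') b = cross a b + cross a' b"
  by (simp add: cross_def algebra_simps)

lemma cross_self: "cross a a = 0"
  by (simp add: cross_def)

lemma parallel_if_cross_zero:
  assumes "cross v u = 0" "u \<noteq> 0"
  shows "v = (inner v u / inner u u) *\<^sub>R u"
proof -
  have nz: "inner u u \<noteq> 0" using assms(2) by simp
  obtain v1 v2 u1 u2 where eq: "v = (v1, v2)" "u = (u1, u2)" by (cases v, cases u)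
  have c: "v1 * u2 = v2 * u1" using assms(1) by (simp add: cross_def eq)
  have "inner u u *\<^sub>R v = inner v u *\<^sub>R u"
  proof -
    have "(u1 * u1 + u2 * u2) * v1 = (v1 * u1 + v2 * u2) * u1"
      "(u1 * u1 + u2 * u2) * v2 = (v1 * u1 + v2 * u2) * u2" using c by algebra+
    then show ?thesis by (simp add: eq inner_prod_def)
  qed
  then have "v = (1 / inner u u) *\<^sub>R (inner v u *\<^sub>R u)" using nz
    by (metis divide_inverse eq_vector_fraction_iff mult.left_neutral scaleR_scaleR)
  then show ?thesis by simp
qed

lemma collinear_if_cross_zero:
  assumes "cross (b - a) (c - a) = 0"
  shows "collinear {a, b, c}"
proof (cases "c = a")
  case False
  then have "\<exists>t. b - a = t *\<^sub>R (c - a)" using parallel_if_cross_zero[OF assms] by auto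
  then have "collinear {0, c - a, b - a}" by (auto simp: collinear_lemma)
  then have "collinear {c, a, b}" by (simp add: collinear_3)
  then show ?thesis by (simp add: insert_commute)
qed (simp add: insert_commute)

text \<open>Both \<open>b\<close> and \<open>c\<close> lie on one ray from \<open>a\<close>, and
  \<open>c\<close> is off the segment from \<open>a\<close> to \<open>b\<close>, so it comes after
  \<open>b\<close>. This turns the ban on vertices inside edges into an order along the ray.\<close>

lemma sgn_inner_beyond:
  assumes "cross (b - a) u = 0" "cross (c - a) u = 0"
    and "sgn (inner (c - a) u) = sgn (inner (b - a) u)" "inner (b - a) u \<noteq> 0"
    and "c \<notin> closed_segment a b"
  shows "sgn (inner (c - b) u) = sgn (inner (b - a) u)"
proof -
  define \<beta> \<gamma> where "\<beta> = inner (b - a) u" and "\<gamma> = inner (c - a) u"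
  have u: "u \<noteq> 0" using assms(4) by auto
  have b: "b - a = (\<beta> / inner u u) *\<^sub>R u" and c: "c - a = (\<gamma> / inner u u) *\<^sub>R u"
    using parallel_if_cross_zero[OF assms(1) u] parallel_if_cross_zero[OF assms(2) u]
    by (simp_all add: \<beta>_def \<gamma>_def)
  have nz: "\<beta> \<noteq> 0" "sgn \<gamma> = sgn \<beta>" using assms by (simp_all add: \<beta>_def \<gamma>_def)
  define \<tau> where "\<tau> = \<gamma> / \<beta>"
  have \<tau>: "\<tau> > 0" using nz by (auto simp: \<tau>_def sgn_if zero_less_divide_iff split: if_splits)
  have "c - a = \<tau> *\<^sub>R (b - a)" unfolding b c \<tau>_def using nz(1) by simp
  then have c': "c = (1 - \<tau>) *\<^sub>R a + \<tau> *\<^sub>R b" by (simp add: algebra_simps)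
  have "\<not> \<tau> \<le> 1"
    using assms(5) \<tau> unfolding in_segment c' by (metis less_imp_le)
  moreover have "inner (c - b) u = (\<tau> - 1) * \<beta>"
    unfolding c' \<beta>_def by (simp add: algebra_simps inner_diff_left inner_add_left)
  ultimately show ?thesis by (simp add: \<beta>_def[symmetric] sgn_mult)
qed

section \<open>From slopes to direction vectors\<close>

definition slope_dir :: "ereal \<Rightarrow> real \<times> real" where
  "slope_dir s = (if s = \<infinity> then (0, 1) else (1, real_of_ereal s))"

lemma diff_eq_scaled_slope_dir: "\<exists>t. b - a = t *\<^sub>R slope_dir (slope a b)"
proof (cases "fst a = fst b")
  case True
  then have "b - a = (snd b - snd a) *\<^sub>R slope_dir (slope a b)"
    by (simp add: slope_def slope_dir_def prod_eq_iff)
  then show ?thesis by blast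
next
  case False
  then have "b - a = (fst b - fst a) *\<^sub>R slope_dir (slope a b)"
    by (simp add: slope_def slope_dir_def prod_eq_iff)
  then show ?thesis by blast
qed

text \<open>Direction vectors instead of slopes, so that vertical edges need no special treatment.\<close>

definition dirvec :: "(nat \<Rightarrow> real) \<Rightarrow> nat \<Rightarrow> real \<times> real" where
  "dirvec x j = (x (2 * j), x (2 * j + 1))"

text \<open>An infinite set has \<open>card\<close> 0, so a bound on the number of slopes says
  something only once finiteness is known.\<close>

lemma finite_edge_slopes:
  assumes E: "finite E"
  shows "finite (edge_slopes E p)"
proof -
  have "edge_slopes E p \<subseteq> (\<lambda>e. slope (p (fst e)) (p (snd e))) ` {e. {fst e, snd e} \<in> E}"
  proof
    fix s assume "s \<in> edge_slopes E p"
    then obtain u v where "s = slope (p u) (p v)" "{u, v} \<in> E" by (auto simp: edge_slopes_def)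
    then show "s \<in> (\<lambda>e. slope (p (fst e)) (p (snd e))) ` {e. {fst e, snd e} \<in> E}"
      by (intro image_eqI[of _ _ "(u, v)"]) simp_all
  qed
  moreover have "finite {e. {fst e, snd e} \<in> E}"
  proof (rule finite_subset)
    have "finite {a. \<exists>b. {a, b} \<in> E}"
    proof (rule finite_subset)
      show "{a. \<exists>b. {a, b} \<in> E} \<subseteq> \<Union> {e \<in> E. finite e}" by auto
    qed (use E in auto)
    then show "finite ({a. \<exists>b. {a, b} \<in> E} \<times> {a. \<exists>b. {a, b} \<in> E})" by simp
    show "{e. {fst e, snd e} \<in> E} \<subseteq> {a. \<exists>b. {a, b} \<in> E} \<times> {a. \<exists>b. {a, b} \<in> E}"
    proof
      fix e assume "e \<in> {e. {fst e, snd e} \<in> E}"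
      then have "{fst e, snd e} \<in> E" "{snd e, fst e} \<in> E" by (simp_all add: insert_commute)
      then show "e \<in> {a. \<exists>b. {a, b} \<in> E} \<times> {a. \<exists>b. {a, b} \<in> E}"
        unfolding mem_Times_iff by blast
    qed
  qed
  ultimately show ?thesis by (meson finite_imageI finite_subset)
qed

text \<open>The directions are packed into the first \<open>2 * k\<close> coordinates of
  \<open>x\<close>, horizontal components at even places. The others are 0, as the bound on sign
  vectors demands.\<close>

lemma drawing_directions:
  assumes E: "finite E" and k: "card (edge_slopes E p) \<le> k"
  shows "\<exists>x. (\<forall>i\<ge>2 * k. x i = 0) \<and> (\<forall>u v. {u, v} \<in> E \<longrightarrow> (\<exists>j<k. \<exists>t. p v - p u = t *\<^sub>R dirvec x j))"
proof -
  have "finite (edge_slopes E p)" using E by (rule finite_edge_slopes)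
  then obtain g where "bij_betw g {0..<card (edge_slopes E p)} (edge_slopes E p)"
    using ex_bij_betw_nat_finite by blast
  then have g: "\<exists>j<k. s = g j" if "s \<in> edge_slopes E p" for s
  proof -
    have "s \<in> g ` {0..<card (edge_slopes E p)}"
      using that \<open>bij_betw g _ _\<close> by (simp add: bij_betw_def)
    then obtain j where "j < card (edge_slopes E p)" "s = g j" by auto
    then show ?thesis using k by (intro exI[of _ j]) simp
  qed
  define x where "x i = (if i < 2 * k then if even i then fst (slope_dir (g (i div 2)))
    else snd (slope_dir (g (i div 2))) else 0)" for i
  have x: "dirvec x j = slope_dir (g j)" if "j < k" for j
    using that by (simp add: dirvec_def x_def)
  have "\<exists>j<k. \<exists>t. p v - p u = t *\<^sub>R dirvec x j" if uv: "{u, v} \<in> E" for u v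
  proof -
    have "slope (p u) (p v) \<in> edge_slopes E p" using uv by (auto simp: edge_slopes_def)
    then obtain j where "j < k" "slope (p u) (p v) = g j" using g by blast
    then show ?thesis using diff_eq_scaled_slope_dir[where a = "p u" and b = "p v"] x by auto
  qed
  then show ?thesis by (intro exI[of _ x]) (auto simp: x_def)
qed

text \<open>If consecutive frame edges are \<open>l i\<close> times their direction vectors, closing the triangle
  \<open>i, i + 1, i + 2\<close> says that \<open>l (i + 1) / l i\<close> is minus a quotient of two cross products.
  Clearing all denominators turns the lengths, up to a common factor, into the polynomials below.\<close>

definition frame_len :: "(nat \<Rightarrow> nat) \<Rightarrow> (nat \<Rightarrow> nat) \<Rightarrow> nat \<Rightarrow> nat \<Rightarrow> (nat \<Rightarrow> real) \<Rightarrow> real" where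
  "frame_len c c' M i x = (\<Prod>j<i. - cross (dirvec x (c j)) (dirvec x (c' j))) *
     (\<Prod>j\<in>{i..<M - 2}. cross (dirvec x (c (Suc j))) (dirvec x (c' j)))"

definition frame_pos ::
    "(nat \<Rightarrow> nat) \<Rightarrow> (nat \<Rightarrow> nat) \<Rightarrow> nat \<Rightarrow> nat \<Rightarrow> (nat \<Rightarrow> real) \<Rightarrow> real \<times> real" where
  "frame_pos c c' M i x = (\<Sum>l<i. frame_len c c' M l x *\<^sub>R dirvec x (c l))"

lemma frame_rigid:
  assumes M: "M \<ge> 3"
    and e1: "\<And>i. Suc i < M \<Longrightarrow> \<exists>t. p (Suc i) - p i = t *\<^sub>R dirvec x (c i)"
    and e2: "\<And>i. i + 2 < M \<Longrightarrow> \<exists>t. p (i + 2) - p i = t *\<^sub>R dirvec x (c' i)"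
    and nd: "\<And>i. i + 2 < M \<Longrightarrow> \<not> collinear {p i, p (Suc i), p (i + 2)}"
  shows "\<exists>\<rho>. \<rho> \<noteq> 0 \<and> (\<forall>i<M. frame_pos c c' M i x = \<rho> *\<^sub>R (p i - p 0))"
proof -
  define A where "A j = cross (dirvec x (c j)) (dirvec x (c' j))" for j
  define B where "B j = cross (dirvec x (c (Suc j))) (dirvec x (c' j))" for j
  define \<mu> where "\<mu> i = frame_len c c' M i x" for i
  obtain l where l: "\<And>i. Suc i < M \<Longrightarrow> p (Suc i) - p i = l i *\<^sub>R dirvec x (c i)"
    using e1 by metis
  obtain t where t: "\<And>i. i + 2 < M \<Longrightarrow> p (i + 2) - p i = t i *\<^sub>R dirvec x (c' i)"
    using e2 by metis
  \<comment> \<open>The cross product of two sides of a triangle is nonzero, and it factors into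
    \<open>l i\<close>, \<open>t i\<close> and \<open>A i\<close>.\<close>
  have A: "l i \<noteq> 0 \<and> A i \<noteq> 0 \<and> t i \<noteq> 0" if "i + 2 < M" for i
  proof -
    have "cross (p (Suc i) - p i) (p (i + 2) - p i) \<noteq> 0"
      using nd[OF that] collinear_if_cross_zero by blast
    moreover have "Suc i < M" using that by simp
    ultimately show ?thesis unfolding t[OF that] by (simp add: l cross_scaleR A_def)
  qed
  \<comment> \<open>Crossing the triangle relation with the direction of the third side eliminates
    that side.\<close>
  have AB: "l i * A i + l (Suc i) * B i = 0" if "i + 2 < M" for i
  proof -
    have "l i *\<^sub>R dirvec x (c i) + l (Suc i) *\<^sub>R dirvec x (c (Suc i)) = t i *\<^sub>R dirvec x (c' i)"
      using t[OF that] l[of i] l[of "Suc i"] that by (simp add: algebra_simps)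
    then have "cross (l i *\<^sub>R dirvec x (c i) + l (Suc i) *\<^sub>R dirvec x (c (Suc i))) (dirvec x (c' i)) = 0"
      by (simp add: cross_scaleR cross_self)
    then show ?thesis by (simp add: cross_add_left cross_scaleR A_def B_def)
  qed
  have B: "B i \<noteq> 0" if "i + 2 < M" for i using AB[OF that] A[OF that] by auto
  have \<mu>: "\<mu> (Suc i) * B i = - A i * \<mu> i" if "i + 2 < M" for i
  proof -
    have "(\<Prod>j\<in>{i..<M - 2}. B j) = B i * (\<Prod>j\<in>{Suc i..<M - 2}. B j)"
      using that by (intro prod.atLeast_Suc_lessThan) simp
    then show ?thesis unfolding \<mu>_def frame_len_def A_def[symmetric] B_def[symmetric]
      by (simp add: mult_ac)
  qed
  have \<mu>l: "l i * \<mu> 0 = l 0 * \<mu> i" if "Suc i < M" for i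
    using that
  proof (induction i)
    case (Suc i)
    then have i: "i + 2 < M" by simp
    have "B i * (l (Suc i) * \<mu> 0) = - A i * (l i * \<mu> 0)"
      using AB[OF i] by algebra
    also have "\<dots> = l 0 * (- A i * \<mu> i)" using Suc by simp
    also have "\<dots> = B i * (l 0 * \<mu> (Suc i))" using \<mu>[OF i] by algebra
    finally show ?case using B[OF i] by simp
  qed simp
  have "\<mu> 0 \<noteq> 0" using B unfolding \<mu>_def frame_len_def B_def by auto
  have "l 0 \<noteq> 0" using A[of 0] M by simp
  have "frame_pos c c' M i x = (\<mu> 0 / l 0) *\<^sub>R (p i - p 0)" if "i < M" for i
  proof -
    have "l 0 *\<^sub>R frame_pos c c' M i x = (\<Sum>j<i. (l 0 * \<mu> j) *\<^sub>R dirvec x (c j))"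
      by (simp add: frame_pos_def \<mu>_def scaleR_right.sum)
    also have "\<dots> = (\<Sum>j<i. \<mu> 0 *\<^sub>R (p (Suc j) - p j))"
    proof (rule sum.cong[OF refl])
      fix j assume "j \<in> {..<i}"
      then have j: "Suc j < M" using that by simp
      show "(l 0 * \<mu> j) *\<^sub>R dirvec x (c j) = \<mu> 0 *\<^sub>R (p (Suc j) - p j)"
        unfolding l[OF j] \<mu>l[OF j, symmetric] by (simp add: mult.commute)
    qed
    also have "\<dots> = \<mu> 0 *\<^sub>R (p i - p 0)"
      by (simp add: scaleR_right.sum[symmetric] sum_lessThan_telescope)
    finally have "(1 / l 0) *\<^sub>R l 0 *\<^sub>R frame_pos c c' M i x = (1 / l 0) *\<^sub>R \<mu> 0 *\<^sub>R (p i - p 0)"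
      by simp
    then show ?thesis using \<open>l 0 \<noteq> 0\<close> by simp
  qed
  then show ?thesis using \<open>\<mu> 0 \<noteq> 0\<close> \<open>l 0 \<noteq> 0\<close> by (intro exI[of _ "\<mu> 0 / l 0"]) simp
qed

text \<open>With \<open>b\<close> it tests whether \<open>v\<close> is on the line through
  \<open>u\<close> in direction \<open>j\<close>; otherwise its sign tells on which side of
  \<open>u\<close> it lies along that direction. One index type for both kinds lets a single sign
  vector record everything.\<close>

definition frame_feature :: "(nat \<Rightarrow> nat) \<Rightarrow> (nat \<Rightarrow> nat) \<Rightarrow> nat \<Rightarrow> nat \<times> nat \<times> nat \<times> bool \<Rightarrow>
    (nat \<Rightarrow> real) \<Rightarrow> real" where
  "frame_feature c c' M = (\<lambda>(u, v, j, b) x.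
     (if b then cross else inner) (frame_pos c c' M v x - frame_pos c c' M u x) (dirvec x j))"

text \<open>Degree count: a length has at most \<open>M\<close> quadratic factors, a position has
  one more direction vector, and a feature another one.\<close>

lemma bpoly_frame_feature:
  assumes c: "\<And>i. i < M \<Longrightarrow> c i < k" "\<And>i. i < M \<Longrightarrow> c' i < k" and uv: "u < M" "v < M" "j < k"
  shows "bpoly (2 * k) (2 * M + 2) (frame_feature c c' M (u, v, j, b))"
proof -
  have dir: "bpoly (2 * k) 1 (\<lambda>x. fst (dirvec x j))" "bpoly (2 * k) 1 (\<lambda>x. snd (dirvec x j))"
    if "j < k" for j
    using bpoly_coord[of "2 * j" "2 * k" 0] bpoly_coord[of "2 * j + 1" "2 * k" 0] that
    by (simp_all add: dirvec_def)
  have cr: "bpoly (2 * k) 2 (\<lambda>x. cross (dirvec x i) (dirvec x j))" if "i < k" "j < k" for i j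
    unfolding cross_def
    by (intro bpoly_diff bpoly_mult'[OF dir(1)[OF that(1)] dir(2)[OF that(2)]]
        bpoly_mult'[OF dir(2)[OF that(1)] dir(1)[OF that(2)]]) simp_all
  have len: "bpoly (2 * k) (2 * M) (frame_len c c' M i)" if "i < M" for i
  proof -
    have "bpoly (2 * k) (card {..<i} * 2) (\<lambda>x. \<Prod>j<i. - cross (dirvec x (c j)) (dirvec x (c' j)))"
      by (rule bpoly_prod) (use that c in \<open>auto intro!: bpoly_uminus cr\<close>)
    moreover have "bpoly (2 * k) (card {i..<M - 2} * 2)
        (\<lambda>x. \<Prod>j\<in>{i..<M - 2}. cross (dirvec x (c (Suc j))) (dirvec x (c' j)))"
      by (rule bpoly_prod) (use c in \<open>auto intro!: cr\<close>)
    moreover have "card {..<i} * 2 + card {i..<M - 2} * 2 \<le> 2 * M" using that by simp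
    ultimately show ?thesis unfolding frame_len_def by (rule bpoly_mult')
  qed
  have pos: "bpoly (2 * k) (2 * M + 1) (\<lambda>x. fst (frame_pos c c' M i x))"
    "bpoly (2 * k) (2 * M + 1) (\<lambda>x. snd (frame_pos c c' M i x))" if "i < M" for i
    unfolding frame_pos_def fst_sum snd_sum fst_scaleR snd_scaleR real_scaleR_def
    using that c
    by (auto intro!: bpoly_sum bpoly_mult'[OF len dir(1)] bpoly_mult'[OF len dir(2)])
  have comp: "bpoly (2 * k) (2 * M + 2)
      (\<lambda>x. (g (frame_pos c c' M v x) - g (frame_pos c c' M u x)) * h (dirvec x j))"
    if "g \<in> {fst, snd}" "h \<in> {fst, snd}" for g h
    by (rule bpoly_mult'[of _ "2 * M + 1" _ 1])
      (use that pos[OF uv(1)] pos[OF uv(2)] dir[OF uv(3)] in \<open>auto intro: bpoly_diff\<close>)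
  show ?thesis
  proof (cases b)
    case True
    have "bpoly (2 * k) (2 * M + 2) (\<lambda>x.
        (fst (frame_pos c c' M v x) - fst (frame_pos c c' M u x)) * snd (dirvec x j) -
        (snd (frame_pos c c' M v x) - snd (frame_pos c c' M u x)) * fst (dirvec x j))"
      by (intro bpoly_diff comp) simp_all
    then show ?thesis using True by (simp add: frame_feature_def cross_def)
  next
    case False
    have "bpoly (2 * k) (2 * M + 2) (\<lambda>x.
        (fst (frame_pos c c' M v x) - fst (frame_pos c c' M u x)) * fst (dirvec x j) +
        (snd (frame_pos c c' M v x) - snd (frame_pos c c' M u x)) * snd (dirvec x j))"
      by (intro bpoly_add comp) simp_all
    then show ?thesis using False by (simp add: frame_feature_def inner_prod_def)
  qed
qed

section \<open>Edge sets of the graph and existence of drawings\<close>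

text \<open>The square of a path: any three consecutive vertices form a triangle, which makes the
  frame rigid.\<close>

definition frame_edges :: "nat \<Rightarrow> nat set set" where
  "frame_edges M = {{i, Suc i} | i. Suc i < M} \<union> {{i, i + 2} | i. i + 2 < M}"

text \<open>For permutations \<open>\<sigma> r\<close> of the first \<open>m\<close> numbers these
  are \<open>q\<close> perfect matchings, which may share edges.\<close>

definition matching_edges :: "nat \<Rightarrow> nat \<Rightarrow> (nat \<Rightarrow> nat \<Rightarrow> nat) \<Rightarrow> nat set set" where
  "matching_edges m q \<sigma> = {{i, m + \<sigma> r i} | i r. i < m \<and> r < q}"

definition star_edges :: "nat \<Rightarrow> nat \<Rightarrow> nat set set" where
  "star_edges a d = {{a, a + Suc j} | j. j < d}"

lemma finite_frame_edges: "finite (frame_edges M)"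
proof -
  have "frame_edges M \<subseteq> (\<lambda>i. {i, Suc i}) ` {..<M} \<union> (\<lambda>i. {i, i + 2}) ` {..<M}"
    by (auto simp: frame_edges_def)
  then show ?thesis by (rule finite_subset) simp
qed

lemma finite_matching_edges: "finite (matching_edges m q \<sigma>)"
proof -
  have "matching_edges m q \<sigma> = (\<lambda>(i, r). {i, m + \<sigma> r i}) ` ({..<m} \<times> {..<q})"
    by (auto simp: matching_edges_def)
  then show ?thesis by simp
qed

lemma finite_star_edges: "finite (star_edges a d)"
  by (simp add: star_edges_def)

lemma straight_line_drawing_exists: "\<exists>p. straight_line_drawing (V :: nat set) E p"
proof (intro exI)
  define p where "p v = (real v, real v ^ 2)" for v
  have seg: "w = u \<or> w = v" if "p w \<in> closed_segment (p u) (p v)" for u v w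
  proof -
    from that have "\<exists>t. 0 \<le> t \<and> t \<le> 1 \<and> p w = (1 - t) *\<^sub>R p u + t *\<^sub>R p v"
      by (simp only: in_segment)
    then obtain t where t: "p w = (1 - t) *\<^sub>R p u + t *\<^sub>R p v" by metis
    have w: "real w = (1 - t) * real u + t * real v"
      using arg_cong[OF t, of fst] by (simp add: p_def)
    have "real w ^ 2 = (1 - t) * real u ^ 2 + t * real v ^ 2"
      using arg_cong[OF t, of snd] by (simp add: p_def)
    \<comment> \<open>The height of the chord above the parabola is exactly this product.\<close>
    with w have "t * (1 - t) * (real u - real v) ^ 2 = 0" by algebra
    then consider "t = 0" | "t = 1" | "u = v" by auto
    then show ?thesis using w by cases (simp_all add: algebra_simps)
  qed
  have "inj_on p V" by (auto simp: inj_on_def p_def)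
  then show "straight_line_drawing V E p"
    unfolding straight_line_drawing_def using seg by blast
qed

lemma slope_number_attained:
  "\<exists>p. straight_line_drawing (V :: nat set) E p \<and> card (edge_slopes E p) \<le> slope_number V E"
proof -
  have "\<exists>s p. straight_line_drawing V E p \<and> card (edge_slopes E p) \<le> s"
    using straight_line_drawing_exists by blast
  then show ?thesis unfolding slope_number_def by (rule LeastI_ex)
qed

text \<open>The colours \<open>c\<close>, \<open>c'\<close> determine the shape of the frame from the slopes \<open>x\<close>, and \<open>\<kappa> (i, r)\<close> tells
  on which ray from \<open>i\<close> its \<open>r\<close>-th partner lies.\<close>

definition encodes :: "nat \<Rightarrow> nat \<Rightarrow> nat \<Rightarrow> (nat \<Rightarrow> nat \<Rightarrow> nat) \<Rightarrow> (nat \<Rightarrow> real) \<Rightarrow>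
    (nat \<Rightarrow> nat) \<Rightarrow> (nat \<Rightarrow> nat) \<Rightarrow> (nat \<times> nat \<Rightarrow> nat \<times> real) \<Rightarrow> bool" where
  "encodes k m q \<sigma> x c c' \<kappa> \<longleftrightarrow> (\<forall>i\<ge>2 * k. x i = 0) \<and>
     c \<in> PiE {..<2 * m} (\<lambda>_. {..<k}) \<and> c' \<in> PiE {..<2 * m} (\<lambda>_. {..<k}) \<and>
     \<kappa> \<in> PiE ({..<m} \<times> {..<q}) (\<lambda>_. {..<k} \<times> {-1, 1}) \<and>
     (\<forall>i<m. \<forall>r<q. (let v = m + \<sigma> r i; j = fst (\<kappa> (i, r)) in
        frame_feature c c' (2 * m) (i, v, j, True) x = 0 \<and>
        sgn (frame_feature c c' (2 * m) (i, v, j, False) x) = snd (\<kappa> (i, r)) \<and>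
        (\<forall>w<2 * m. w \<noteq> i \<and> w \<noteq> v \<longrightarrow> frame_pos c c' (2 * m) w x \<notin>
           closed_segment (frame_pos c c' (2 * m) i x) (frame_pos c c' (2 * m) v x))))"

text \<open>The colours are the slopes of the edges. By \<open>frame_rigid\<close> the rebuilt frame
  is a translated and scaled copy of the drawing, so collinearity and absence from segments carry
  over.\<close>

lemma drawing_encoding:
  assumes m: "m \<ge> 2" and k: "k > 0" and V: "{..<2 * m} \<subseteq> V"
    and E: "frame_edges (2 * m) \<union> matching_edges m q \<sigma> \<subseteq> E" "finite E"
    and \<sigma>: "\<And>r i. r < q \<Longrightarrow> i < m \<Longrightarrow> \<sigma> r i < m"
    and p: "straight_line_drawing V E p" "card (edge_slopes E p) \<le> k"
  shows "\<exists>x c c' \<kappa>. encodes k m q \<sigma> x c c' \<kappa>"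
proof -
  define M where "M = 2 * m"
  have M: "M \<ge> 3" "{..<M} \<subseteq> V" using m V by (simp_all add: M_def)
  obtain x where x: "\<forall>i\<ge>2 * k. x i = 0"
    and dir: "\<And>u v. {u, v} \<in> E \<Longrightarrow> \<exists>j<k. \<exists>t. p v - p u = t *\<^sub>R dirvec x j"
    using drawing_directions[OF E(2) p(2)] by blast
  have inj: "inj_on p V" and
    off: "\<And>u v w. {u, v} \<in> E \<Longrightarrow> w \<in> V \<Longrightarrow> w \<noteq> u \<Longrightarrow> w \<noteq> v \<Longrightarrow> p w \<notin> closed_segment (p u) (p v)"
    using p(1) by (auto simp: straight_line_drawing_def)
  have E1: "{i, Suc i} \<in> E" if "Suc i < M" for i
    using that E(1) by (auto simp: frame_edges_def M_def)
  have E2: "{i, i + 2} \<in> E" if "i + 2 < M" for i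
    using that E(1) by (auto simp: frame_edges_def M_def)
  \<comment> \<open>The implication makes the choice total, and \<open>k > 0\<close> supplies a
    default colour.\<close>
  have "\<forall>i. \<exists>j<k. Suc i < M \<longrightarrow> (\<exists>t. p (Suc i) - p i = t *\<^sub>R dirvec x j)"
    using dir[OF E1] k by meson
  then obtain c0 where c0: "\<And>i. c0 i < k"
    "\<And>i. Suc i < M \<Longrightarrow> \<exists>t. p (Suc i) - p i = t *\<^sub>R dirvec x (c0 i)" by metis
  have "\<forall>i. \<exists>j<k. i + 2 < M \<longrightarrow> (\<exists>t. p (i + 2) - p i = t *\<^sub>R dirvec x j)"
    using dir[OF E2] k by meson
  then obtain c0' where c0': "\<And>i. c0' i < k"
    "\<And>i. i + 2 < M \<Longrightarrow> \<exists>t. p (i + 2) - p i = t *\<^sub>R dirvec x (c0' i)" by metis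
  \<comment> \<open>Restriction puts the colourings into a finite \<open>PiE\<close>.\<close>
  define c c' where "c = restrict c0 {..<M}" and "c' = restrict c0' {..<M}"
  \<comment> \<open>Of three collinear points one lies between the others, but no vertex lies on an
    edge of the triangle.\<close>
  have nd: "\<not> collinear {p i, p (Suc i), p (i + 2)}" if i: "i + 2 < M" for i
  proof -
    have "i \<in> V" "Suc i \<in> V" "i + 2 \<in> V" using M(2) i by auto
    then have "p i \<notin> closed_segment (p (Suc i)) (p (i + 2))"
      "p (Suc i) \<notin> closed_segment (p i) (p (i + 2))" "p (i + 2) \<notin> closed_segment (p i) (p (Suc i))"
      using off[OF E1[of "Suc i"], of i] off[OF E2[OF i], of "Suc i"] off[OF E1[of i], of "i + 2"] i
      by simp_all
    then show ?thesis
      by (simp add: collinear_between_cases between_mem_segment closed_segment_commute)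
  qed
  have "\<exists>\<rho>. \<rho> \<noteq> 0 \<and> (\<forall>i<M. frame_pos c c' M i x = \<rho> *\<^sub>R (p i - p 0))"
    by (rule frame_rigid[OF M(1) _ _ nd]) (use c0(2) c0'(2) in \<open>simp_all add: c_def c'_def\<close>)
  then obtain \<rho> where \<rho>: "\<rho> \<noteq> 0" "\<And>i. i < M \<Longrightarrow> frame_pos c c' M i x = \<rho> *\<^sub>R (p i - p 0)"
    by blast
  have seg: "p w \<in> closed_segment (p u) (p v)"
    if uvw: "u < M" "v < M" "w < M" and
      w: "frame_pos c c' M w x \<in> closed_segment (frame_pos c c' M u x) (frame_pos c c' M v x)" for u v w
  proof -
    obtain t where t: "0 \<le> t" "t \<le> 1" "\<rho> *\<^sub>R (p w - p 0) =
        (1 - t) *\<^sub>R (\<rho> *\<^sub>R (p u - p 0)) + t *\<^sub>R (\<rho> *\<^sub>R (p v - p 0))"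
      using w unfolding in_segment \<rho>(2)[OF uvw(1)] \<rho>(2)[OF uvw(2)] \<rho>(2)[OF uvw(3)] by blast
    then have "\<rho> *\<^sub>R p w = \<rho> *\<^sub>R ((1 - t) *\<^sub>R p u + t *\<^sub>R p v)" by (simp add: algebra_simps)
    then have "p w = (1 - t) *\<^sub>R p u + t *\<^sub>R p v" using \<rho>(1) by simp
    then show ?thesis using t by (auto simp: in_segment)
  qed
  have edge: "{i, m + \<sigma> r i} \<in> E" if "i < m" "r < q" for i r
    using that E(1) by (auto simp: matching_edges_def)
  have "\<forall>i r. \<exists>j<k. i < m \<and> r < q \<longrightarrow> (\<exists>t. p (m + \<sigma> r i) - p i = t *\<^sub>R dirvec x j)"
    using dir[OF edge] k by meson
  then obtain g where g: "\<And>i r. g i r < k"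
    "\<And>i r. i < m \<Longrightarrow> r < q \<Longrightarrow> \<exists>t. p (m + \<sigma> r i) - p i = t *\<^sub>R dirvec x (g i r)" by metis
  define F where "F = frame_feature c c' M"
  \<comment> \<open>The sign is read off the rebuilt frame, so a negative \<open>\<rho>\<close> does
    no harm.\<close>
  define \<kappa> where "\<kappa> = (\<lambda>(i, r)\<in>{..<m} \<times> {..<q}. (g i r, sgn (F (i, m + \<sigma> r i, g i r, False) x)))"
  have F: "F (i, m + \<sigma> r i, g i r, True) x = 0" "F (i, m + \<sigma> r i, g i r, False) x \<noteq> 0"
    if i: "i < m" and r: "r < q" for i r
  proof -
    obtain t where t: "p (m + \<sigma> r i) - p i = t *\<^sub>R dirvec x (g i r)" using g(2)[OF i r] by blast
    have lt: "m + \<sigma> r i < M" "i < M" using \<sigma>[OF r i] i by (simp_all add: M_def)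
    then have "m + \<sigma> r i \<in> V" "i \<in> V" "m + \<sigma> r i \<noteq> i" using M(2) i by auto
    then have "p (m + \<sigma> r i) \<noteq> p i" using inj by (auto dest: inj_onD)
    then have nz: "t \<noteq> 0" "dirvec x (g i r) \<noteq> 0" using t by auto
    have "frame_pos c c' M (m + \<sigma> r i) x - frame_pos c c' M i x = \<rho> *\<^sub>R (p (m + \<sigma> r i) - p i)"
      by (simp add: \<rho>(2)[OF lt(1)] \<rho>(2)[OF lt(2)] algebra_simps)
    then have "frame_pos c c' M (m + \<sigma> r i) x - frame_pos c c' M i x = (\<rho> * t) *\<^sub>R dirvec x (g i r)"
      by (simp add: t)
    then show "F (i, m + \<sigma> r i, g i r, True) x = 0" "F (i, m + \<sigma> r i, g i r, False) x \<noteq> 0"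
      using nz \<rho>(1) by (simp_all add: F_def frame_feature_def cross_scaleR cross_self)
  qed
  have "encodes k m q \<sigma> x c c' \<kappa>"
    unfolding encodes_def M_def[symmetric] F_def[symmetric] Let_def
  proof (intro conjI allI impI)
    show "c \<in> PiE {..<M} (\<lambda>_. {..<k})" "c' \<in> PiE {..<M} (\<lambda>_. {..<k})"
      using c0(1) c0'(1) by (auto simp: c_def c'_def)
    show "\<kappa> \<in> PiE ({..<m} \<times> {..<q}) (\<lambda>_. {..<k} \<times> {-1, 1})"
      using g(1) F(2) by (auto simp: \<kappa>_def sgn_if split: if_splits)
    fix i r assume ir: "i < m" "r < q"
    then show "F (i, m + \<sigma> r i, fst (\<kappa> (i, r)), True) x = 0"
      "sgn (F (i, m + \<sigma> r i, fst (\<kappa> (i, r)), False) x) = snd (\<kappa> (i, r))"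
      using F(1) by (simp_all add: \<kappa>_def)
    fix w assume w: "w < M" "w \<noteq> i \<and> w \<noteq> m + \<sigma> r i"
    then have "p w \<notin> closed_segment (p i) (p (m + \<sigma> r i))"
      using M(2) by (intro off[OF edge[OF ir]]) auto
    then show "frame_pos c c' M w x \<notin>
        closed_segment (frame_pos c c' M i x) (frame_pos c c' M (m + \<sigma> r i) x)"
      using seg[of i "m + \<sigma> r i" w] ir \<sigma>[OF ir(2,1)] w(1) by (auto simp: M_def)
  qed (use x in auto)
  then show ?thesis by blast
qed

text \<open>Equal signs put different partners \<open>v\<close> and \<open>v'\<close> on one ray
  from \<open>i\<close> in both frames. In the first frame \<open>v'\<close> comes after
  \<open>v\<close>, in the second \<open>v\<close> after \<open>v'\<close>; yet the sign that
  records their order is the same.\<close>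

lemma encoding_determines_partners:
  assumes enc: "encodes k m q \<sigma> x c c' \<kappa>" "encodes k m q \<sigma>' x' c c' \<kappa>"
    and sgn: "\<And>u v j b. u < 2 * m \<Longrightarrow> v < 2 * m \<Longrightarrow> j < k \<Longrightarrow>
      sgn (frame_feature c c' (2 * m) (u, v, j, b) x) = sgn (frame_feature c c' (2 * m) (u, v, j, b) x')"
    and ir: "i < m" "r < q" and \<sigma>: "\<sigma> r i < m" "\<sigma>' r i < m"
  shows "\<sigma> r i = \<sigma>' r i"
proof (rule ccontr)
  assume ne: "\<sigma> r i \<noteq> \<sigma>' r i"
  define v v' where "v = m + \<sigma> r i" and "v' = m + \<sigma>' r i"
  define j s where "j = fst (\<kappa> (i, r))" and "s = snd (\<kappa> (i, r))"
  have "\<kappa> (i, r) \<in> {..<k} \<times> {-1, 1}" using enc(1) ir by (auto simp: encodes_def)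
  then have js: "j < k" "s \<noteq> 0" by (auto simp: j_def s_def mem_Times_iff)
  have lt: "i < 2 * m" "v < 2 * m" "v' < 2 * m" "v \<noteq> v'" "v \<noteq> i" "v' \<noteq> i"
    using ir \<sigma> ne by (simp_all add: v_def v'_def)
  define P P' where "P w = frame_pos c c' (2 * m) w x" and "P' w = frame_pos c c' (2 * m) w x'" for w
  let ?u = "dirvec x j" and ?u' = "dirvec x' j"
  have P: "cross (P v - P i) ?u = 0" "sgn (inner (P v - P i) ?u) = s" "P v' \<notin> closed_segment (P i) (P v)"
    using enc(1) ir lt
    by (auto simp: encodes_def Let_def v_def j_def s_def P_def frame_feature_def)
  have P': "cross (P' v' - P' i) ?u' = 0" "sgn (inner (P' v' - P' i) ?u') = s"
    "P' v \<notin> closed_segment (P' i) (P' v')"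
    using enc(2) ir lt
    by (auto simp: encodes_def Let_def v'_def j_def s_def P'_def frame_feature_def)
  have crs: "sgn (cross (P b - P a) ?u) = sgn (cross (P' b - P' a) ?u')"
    and inn: "sgn (inner (P b - P a) ?u) = sgn (inner (P' b - P' a) ?u')"
    if "a < 2 * m" "b < 2 * m" for a b
    using sgn[OF that js(1), of True] sgn[OF that js(1), of False]
    by (simp_all add: frame_feature_def P_def P'_def)
  have "sgn (inner (P v' - P v) ?u) = sgn (inner (P v - P i) ?u)"
  proof (rule sgn_inner_beyond)
    show "cross (P v' - P i) ?u = 0" using crs[OF lt(1,3)] P'(1) by (simp add: sgn_eq_0_iff)
    show "sgn (inner (P v' - P i) ?u) = sgn (inner (P v - P i) ?u)"
      using inn[OF lt(1,3)] P'(2) P(2) by simp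
    show "inner (P v - P i) ?u \<noteq> 0" using P(2) js(2) by auto
  qed (fact P)+
  moreover have "sgn (inner (P' v - P' v') ?u') = sgn (inner (P' v' - P' i) ?u')"
  proof (rule sgn_inner_beyond)
    show "cross (P' v - P' i) ?u' = 0" using crs[OF lt(1,2)] P(1) by (simp add: sgn_eq_0_iff)
    show "sgn (inner (P' v - P' i) ?u') = sgn (inner (P' v' - P' i) ?u')"
      using inn[OF lt(1,2)] P'(2) P(2) by simp
    show "inner (P' v' - P' i) ?u' \<noteq> 0" using P'(2) js(2) by auto
  qed (fact P')+
  moreover have "inner (P' v - P' v') ?u' = - inner (P' v' - P' v) ?u'" by (simp add: inner_diff_left)
  ultimately show False using inn[OF lt(2,3)] P(2) P'(2) js(2) by (simp add: sgn_minus)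
qed

section \<open>Counting\<close>

text \<open>The factors count the colourings \<open>c\<close> and \<open>c'\<close>, the rays
  \<open>\<kappa>\<close>, and the sign vectors of \<open>2 * m * (2 * m * (k * 2))\<close> features
  of degree \<open>2 * (2 * m) + 2\<close> in \<open>2 * k\<close> variables.\<close>

definition encoding_bound :: "nat \<Rightarrow> nat \<Rightarrow> nat \<Rightarrow> nat" where
  "encoding_bound k m q = (k ^ (2 * m))^2 * ((2 * k) ^ (m * q) *
     Suc (2 * k * (2 * (2 * k * 2 + 2 * (2 * m * (2 * m * (k * 2))) * (2 * (2 * m) + 2)))) ^ (2 * k))"

text \<open>Colours, rays and feature signs form a code of the tuple, which is injective by
  \<open>encoding_determines_partners\<close>.\<close>

lemma permutation_tuples_le_encodings:
  fixes q m :: nat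
  defines "\<Sigma> \<equiv> PiE {..<q} (\<lambda>_. {\<pi>. \<pi> permutes {..<m}})"
  assumes enc: "\<And>\<sigma>. \<sigma> \<in> \<Sigma> \<Longrightarrow> \<exists>x c c' \<kappa>. encodes k m q \<sigma> x c c' \<kappa>"
  shows "fact m ^ q \<le> encoding_bound k m q"
proof -
  obtain X C C' K where X: "\<And>\<sigma>. \<sigma> \<in> \<Sigma> \<Longrightarrow> encodes k m q \<sigma> (X \<sigma>) (C \<sigma>) (C' \<sigma>) (K \<sigma>)"
    using enc by metis
  define I where "I = {..<2 * m} \<times> {..<2 * m} \<times> {..<k} \<times> (UNIV :: bool set)"
  define CC where "CC = PiE {..<2 * m} (\<lambda>_. {..<k})"
  define KK where "KK = PiE ({..<m} \<times> {..<q}) (\<lambda>_. {..<k} \<times> {-1, 1 :: real})"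
  define pat where "pat z x = (\<lambda>i\<in>I. sgn (frame_feature (fst z) (snd z) (2 * m) i x))" for z x
  \<comment> \<open>A dependent sum, since the features, and so the possible sign patterns, vary
    with the colours.\<close>
  define T where "T = Sigma (CC \<times> CC) (\<lambda>z. KK \<times> pat z ` (X ` \<Sigma>))"
  define code where "code \<sigma> = ((C \<sigma>, C' \<sigma>), (K \<sigma>, pat (C \<sigma>, C' \<sigma>) (X \<sigma>)))" for \<sigma>
  define B where
    "B = Suc (2 * k * (2 * (2 * k * 2 + 2 * (2 * m * (2 * m * (k * 2))) * (2 * (2 * m) + 2)))) ^ (2 * k)"
  have fin\<Sigma>: "finite \<Sigma>" unfolding \<Sigma>_def by (intro finite_PiE finite_permutations) auto
  have card\<Sigma>: "card \<Sigma> = fact m ^ q"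
    by (simp add: \<Sigma>_def card_PiE card_permutations)
  have finI: "finite I" and cardI: "card I = 2 * m * (2 * m * (k * 2))"
    by (simp_all add: I_def card_cartesian_product)
  have finC: "finite CC" "finite KK" by (auto simp: CC_def KK_def intro!: finite_PiE)
  have cardC: "card CC = k ^ (2 * m)" "card KK = (k * 2) ^ (m * q)"
    by (simp_all add: CC_def KK_def card_PiE card_cartesian_product flip: mult_2_right)
  have cardpat: "card (pat z ` (X ` \<Sigma>)) \<le> B" if z: "z \<in> CC \<times> CC" for z
  proof -
    have "bpoly (2 * k) (2 * (2 * m) + 2) (frame_feature (fst z) (snd z) (2 * m) i)" if i: "i \<in> I" for i
    proof -
      obtain u v j b where uvjb: "i = (u, v, j, b)" by (cases i)
      then have lt: "u < 2 * m" "v < 2 * m" "j < k" using i by (simp_all add: I_def)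
      have "fst z l < k" "snd z l < k" if "l < 2 * m" for l
        using z that by (auto simp: CC_def mem_Times_iff)
      then show ?thesis unfolding uvjb using lt by (rule bpoly_frame_feature)
    qed
    moreover have "x i = 0" if "x \<in> X ` \<Sigma>" "2 * k \<le> i" for x i
      using that X by (auto simp: encodes_def)
    ultimately have "card ((\<lambda>x. \<lambda>i\<in>I. sgn (frame_feature (fst z) (snd z) (2 * m) i x)) ` (X ` \<Sigma>)) \<le>
        Suc (2 * k * (2 * (2 * k * 2 + 2 * card I * (2 * (2 * m) + 2)))) ^ (2 * k)"
      using finI fin\<Sigma> by (intro card_sign_vectors_le[where X = "X ` \<Sigma>"]) blast+
    moreover have "pat z = (\<lambda>x. \<lambda>i\<in>I. sgn (frame_feature (fst z) (snd z) (2 * m) i x))"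
      by (simp add: pat_def fun_eq_iff)
    ultimately show ?thesis unfolding B_def cardI by simp
  qed
  have "inj_on code \<Sigma>"
  proof (rule inj_onI)
    fix \<sigma> \<sigma>' assume \<sigma>: "\<sigma> \<in> \<Sigma>" "\<sigma>' \<in> \<Sigma>" and eq: "code \<sigma> = code \<sigma>'"
    have eqs: "C \<sigma> = C \<sigma>'" "C' \<sigma> = C' \<sigma>'" "K \<sigma> = K \<sigma>'"
      "pat (C \<sigma>, C' \<sigma>) (X \<sigma>) = pat (C \<sigma>, C' \<sigma>) (X \<sigma>')" using eq by (auto simp: code_def)
    have enc': "encodes k m q \<sigma> (X \<sigma>) (C \<sigma>) (C' \<sigma>) (K \<sigma>)"
      "encodes k m q \<sigma>' (X \<sigma>') (C \<sigma>) (C' \<sigma>) (K \<sigma>)" using X[OF \<sigma>(1)] X[OF \<sigma>(2)] eqs by simp_all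
    have sg: "sgn (frame_feature (C \<sigma>) (C' \<sigma>) (2 * m) (u, v, j, b) (X \<sigma>)) =
        sgn (frame_feature (C \<sigma>) (C' \<sigma>) (2 * m) (u, v, j, b) (X \<sigma>'))"
      if "u < 2 * m" "v < 2 * m" "j < k" for u v j b
      using fun_cong[OF eqs(4), of "(u, v, j, b)"] that by (simp add: pat_def I_def)
    show "\<sigma> = \<sigma>'"
    proof (rule PiE_ext)
      show "\<sigma> \<in> PiE {..<q} (\<lambda>_. {\<pi>. \<pi> permutes {..<m}})" "\<sigma>' \<in> PiE {..<q} (\<lambda>_. {\<pi>. \<pi> permutes {..<m}})"
        using \<sigma> by (simp_all add: \<Sigma>_def)
      fix r assume r: "r \<in> {..<q}"
      have perm: "\<sigma> r permutes {..<m}" "\<sigma>' r permutes {..<m}" using \<sigma> r by (auto simp: \<Sigma>_def)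
      show "\<sigma> r = \<sigma>' r"
      proof
        fix i
        show "\<sigma> r i = \<sigma>' r i"
        proof (cases "i < m")
          case True
          have "\<sigma> r i < m" "\<sigma>' r i < m"
            using permutes_in_image[OF perm(1), of i] permutes_in_image[OF perm(2), of i] True by simp_all
          then show ?thesis using encoding_determines_partners[OF enc' sg True] r by simp
        next
          case False
          then show ?thesis using perm by (simp add: permutes_not_in)
        qed
      qed
    qed
  qed
  moreover have "code ` \<Sigma> \<subseteq> T"
  proof -
    have "C \<sigma> \<in> CC \<and> C' \<sigma> \<in> CC \<and> K \<sigma> \<in> KK" if "\<sigma> \<in> \<Sigma>" for \<sigma>
      using X[OF that] unfolding encodes_def CC_def KK_def by blast
    then show ?thesis by (simp add: T_def code_def image_subset_iff)
  qed
  moreover have "finite T"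
    unfolding T_def using finC fin\<Sigma> by (intro finite_SigmaI finite_cartesian_product) auto
  ultimately have "card \<Sigma> \<le> card T" by (rule card_inj_on_le)
  also have "card T = (\<Sum>z\<in>CC \<times> CC. card (KK \<times> pat z ` (X ` \<Sigma>)))"
    unfolding T_def using finC fin\<Sigma> by (intro card_SigmaI) auto
  also have "\<dots> \<le> (\<Sum>z\<in>CC \<times> CC. card KK * B)"
    by (intro sum_mono) (simp add: card_cartesian_product cardpat)
  also have "\<dots> = (k ^ (2 * m))^2 * ((2 * k) ^ (m * q) * B)"
    by (simp add: card_cartesian_product cardC power2_eq_square mult.commute[of 2])
  finally show ?thesis unfolding card\<Sigma> B_def encoding_bound_def .
qed

section \<open>Asymptotic comparison\<close>

lemma exp_ge_power_div_fact:
  fixes x :: real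
  assumes "x \<ge> 0"
  shows "x ^ n / fact n \<le> exp x"
proof -
  have s: "(\<lambda>n. x ^ n / fact n) sums exp x"
    using exp_converges[of x] by (simp add: divide_inverse mult.commute)
  have "(\<Sum>i\<in>{n}. x ^ i / fact i) \<le> exp x"
    unfolding sums_unique[OF s] by (rule sum_le_suminf) (use s assms in \<open>auto simp: sums_iff\<close>)
  then show ?thesis by simp
qed

text \<open>A weak Stirling bound: a single term of the series of \<open>exp m\<close> is at most
  its sum.\<close>

lemma ln_fact_ge:
  assumes "m > 0"
  shows "real m * (ln m - 1) \<le> ln (fact m)"
proof -
  have "real m ^ m / fact m \<le> exp m" by (rule exp_ge_power_div_fact) simp
  then have "ln (real m ^ m / fact m) \<le> ln (exp (real m))" using assms by (subst ln_le_cancel_iff) auto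
  then show ?thesis using assms by (simp add: ln_div ln_realpow algebra_simps)
qed

text \<open>In logarithms, the coefficient of \<open>m * ln n\<close> is at most
  \<open>(4 + q) * a = d * a\<close> for encodings and \<open>q = d - 4\<close> for permutations.
  The sign vectors add at most \<open>m\<close>, because \<open>a < 1\<close>.\<close>

lemma eventually_permutations_exceed_encodings:
  assumes d: "d \<ge> 5"
  shows "\<forall>\<^sub>F n in sequentially. \<forall>k m. 1 \<le> k \<and> real k \<le> real n powr (1 / 2 - 1 / (real d - 2)) \<and>
    m = (n - d - 1) div 2 \<longrightarrow> encoding_bound k m (d - 4)
    < fact m ^ (d - 4)"
proof -
  define a where "a = 1 / 2 - 1 / (real d - 2)"
  define q where "q = real d - 4"
  \<comment> \<open>The gap between the two leading coefficients.\<close>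
  define \<delta> where "\<delta> = q - d * a"
  have a: "0 < a" "a < 1" using d by (auto simp: a_def field_simps)
  have "\<delta> = (real d - 4)^2 / (2 * (real d - 2))"
    using d by (simp add: \<delta>_def q_def a_def field_simps power2_eq_square)
  then have \<delta>: "\<delta> > 0" using d by simp
  have q: "q > 0" "q = real (d - 4)" using d by (auto simp: q_def)
  \<comment> \<open>For the sign vectors: \<open>2 * k * ln b\<close> is at most
    \<open>12 * k * L\<close>, and \<open>n \<le> 3 * m\<close> turns 12 into 36.\<close>
  have "((\<lambda>n. 36 * real n powr (a - 1) * ln (real n)) \<longlongrightarrow> 0) sequentially"
    using a by real_asymp
  then have 1: "\<forall>\<^sub>F n in sequentially. 36 * real n powr (a - 1) * ln (real n) < 1"
    by (rule order_tendstoD) simp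
  have "filterlim (\<lambda>n. \<delta> * ln (real n)) at_top sequentially"
    using \<delta> by real_asymp
  then have 2: "\<forall>\<^sub>F n in sequentially. q * (ln 3 + 1 + ln 2) + 1 < \<delta> * ln (real n)"
    by (simp add: filterlim_at_top_dense)
  show ?thesis
    \<comment> \<open>The 81 gives \<open>81 * n ^ 5 \<le> n ^ 6\<close>; with \<open>4 * d\<close>
      it also ensures \<open>n \<le> 3 * m\<close>.\<close>
    using 1 2 eventually_ge_at_top[of "81 + 4 * d"]
  proof eventually_elim
    case (elim n)
    show ?case
    proof (intro allI impI)
      fix k m assume km: "1 \<le> k \<and> real k \<le> real n powr (1 / 2 - 1 / (real d - 2)) \<and> m = (n - d - 1) div 2"
      define L where "L = ln (real n)"
      have n: "n \<ge> 81" "real n \<ge> 1" using elim by simp_all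
      have m: "real n \<le> 3 * real m" "2 * m \<le> n" "m > 0" using km elim by simp_all
      have ka: "1 \<le> real k" "real k \<le> real n powr a" using km by (simp_all add: a_def)
      moreover have "real n powr a \<le> real n powr 1" using a n by (intro powr_mono) auto
      ultimately have kn: "k \<le> n" using n by simp
      have L: "L \<ge> 0" using n by (simp add: L_def)
      have lnk: "ln k \<le> a * L" "ln k \<ge> 0"
      proof -
        have "ln (real k) \<le> ln (real n powr a)" using ka n by (subst ln_le_cancel_iff) auto
        then show "ln k \<le> a * L" using n by (simp add: L_def ln_powr)
      qed (use ka in simp)
      define b where "b = Suc (2 * k * (2 * (2 * k * 2 + 2 * (2 * m * (2 * m * (k * 2))) * (2 * (2 * m) + 2))))"
      have "b \<le> n ^ 6"
      proof -
        have "b \<le> Suc (2 * n * (2 * (2 * n * 2 + 2 * (n * (n * (n * 2))) * (2 * n + 2 * n))))"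
          unfolding b_def using kn m n by (intro Suc_le_mono[THEN iffD2] mult_le_mono add_mono) simp_all
        also have "\<dots> = 1 + 16 * n ^ 2 + 64 * n ^ 5" by (simp add: algebra_simps power_def numeral_eq_Suc)
        also have "\<dots> \<le> n ^ 5 + 16 * n ^ 5 + 64 * n ^ 5"
          using n by (intro add_mono mult_le_mono power_increasing) simp_all
        also have "\<dots> = 81 * n ^ 5" by simp
        also have "\<dots> \<le> n * n ^ 5" using n by (intro mult_le_mono) simp_all
        finally show ?thesis by (simp add: numeral_eq_Suc)
      qed
      then have "real b \<le> real n ^ 6" by (metis of_nat_le_iff of_nat_power)
      moreover have "b > 0" by (simp add: b_def)
      ultimately have lnb: "ln b \<le> 6 * L"
        using n by (subst (asm) ln_le_cancel_iff[symmetric]) (auto simp: L_def ln_realpow)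
      have "ln n \<le> ln (3 * m)" using m n by (subst ln_le_cancel_iff) auto
      then have lnm: "ln m \<ge> L - ln 3" using m by (simp add: L_def ln_mult)
      have "12 * k * L \<le> m * (36 * real n powr (a - 1) * L)"
      proof -
        have "real n powr a = real n * real n powr (a - 1)" using n by (simp add: powr_mult_base)
        then have "12 * k * L \<le> 12 * (real n * real n powr (a - 1)) * L"
          using ka L by (intro mult_right_mono) auto
        also have "\<dots> \<le> 12 * ((3 * real m) * real n powr (a - 1)) * L"
          using m L by (intro mult_right_mono mult_left_mono) auto
        finally show ?thesis by (simp add: mult_ac)
      qed
      also have "\<dots> \<le> real m * 1" using elim(1) by (intro mult_left_mono) (auto simp: L_def)
      finally have k12: "12 * k * L \<le> m" by simp
      have "ln (real ((k ^ (2 * m))^2 * ((2 * k) ^ (m * (d - 4)) * b ^ (2 * k))))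
          = 4 * m * ln k + m * q * (ln 2 + ln k) + 2 * k * ln b"
      proof -
        have "ln (real ((k ^ (2 * m))^2 * ((2 * k) ^ (m * Q) * b ^ (2 * k))))
            = 4 * m * ln k + m * real Q * (ln 2 + ln k) + 2 * k * ln b" for Q :: nat
          using ka \<open>b > 0\<close> by (simp add: ln_mult ln_realpow algebra_simps)
        then show ?thesis unfolding q(2) .
      qed
      also have "\<dots> \<le> 4 * m * (a * L) + m * q * (ln 2 + a * L) + 2 * k * (6 * L)"
        using lnk lnb q by (intro add_mono mult_left_mono) auto
      also have "\<dots> \<le> m * (d * a * L + q * ln 2 + 1)"
        using k12 by (simp add: q_def algebra_simps)
      also have "\<dots> < m * (q * (L - ln 3 - 1))"
        using elim(2) m(3) by (intro mult_strict_left_mono) (auto simp: L_def \<delta>_def algebra_simps)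
      also have "\<dots> \<le> m * (q * (ln m - 1))" using lnm q by (intro mult_left_mono) auto
      also have "\<dots> \<le> q * ln (fact m)"
        using ln_fact_ge[OF m(3)] q(1) by (metis less_imp_le mult.left_commute mult_left_mono)
      also have "\<dots> = ln (fact m ^ (d - 4))" using q(2) by (simp add: ln_realpow)
      finally have "ln (real ((k ^ (2 * m))^2 * ((2 * k) ^ (m * (d - 4)) * b ^ (2 * k)))) <
        ln (real (fact m ^ (d - 4)))" by simp
      then have "real ((k ^ (2 * m))^2 * ((2 * k) ^ (m * (d - 4)) * b ^ (2 * k))) < real (fact m ^ (d - 4))"
        by (subst (asm) ln_less_cancel_iff) (use ka \<open>b > 0\<close> in auto)
      then show "encoding_bound k m (d - 4)
        < fact m ^ (d - 4)"
        unfolding encoding_bound_def b_def[symmetric] by (simp only: of_nat_less_iff)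
    qed
  qed
qed

text \<open>The star makes the maximum degree exactly \<open>d\<close>.\<close>

definition hard_edges :: "nat \<Rightarrow> nat \<Rightarrow> (nat \<Rightarrow> nat \<Rightarrow> nat) \<Rightarrow> nat set set" where
  "hard_edges d m \<sigma> = frame_edges (2 * m) \<union> matching_edges m (d - 4) \<sigma> \<union> star_edges (2 * m) d"

lemma finite_hard_edges: "finite (hard_edges d m \<sigma>)"
  by (simp add: hard_edges_def finite_frame_edges finite_matching_edges finite_star_edges)

text \<open>A frame vertex has at most 4 frame neighbours and \<open>d - 4\<close> partners. The
  star is centred at \<open>2 * m\<close>, outside the frame, and attains \<open>d\<close>; vertices
  beyond its leaves are isolated.\<close>

lemma hard_graph:
  assumes d: "d \<ge> 4" and n: "2 * m + d < n" and \<sigma>: "\<And>r. r < d - 4 \<Longrightarrow> \<sigma> r permutes {..<m}"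
  shows "simple_graph {..<n} (hard_edges d m \<sigma>)" "max_degree {..<n} (hard_edges d m \<sigma>) = d"
proof -
  let ?E = "hard_edges d m \<sigma>"
  have \<sigma>m: "\<sigma> r i < m" if "r < d - 4" "i < m" for r i
    using permutes_in_image[OF \<sigma>[OF that(1)], of i] that(2) by simp
  show "simple_graph {..<n} ?E"
    unfolding simple_graph_def
  proof (intro conjI ballI)
    fix e assume "e \<in> ?E"
    then consider i where "e = {i, Suc i}" "Suc i < 2 * m" | i where "e = {i, i + 2}" "i + 2 < 2 * m"
      | i r where "e = {i, m + \<sigma> r i}" "i < m" "r < d - 4"
      | j where "e = {2 * m, 2 * m + Suc j}" "j < d"
      unfolding hard_edges_def frame_edges_def matching_edges_def star_edges_def by blast
    then show "e \<subseteq> {..<n}" "card e = 2"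
      using n by (cases; force dest: \<sigma>m simp: card_2_iff)+
  qed simp
  have star: "finite (star_edges (2 * m) d)" "card (star_edges (2 * m) d) = d"
  proof -
    have "star_edges (2 * m) d = (\<lambda>j. {2 * m, 2 * m + Suc j}) ` {..<d}"
      by (auto simp: star_edges_def)
    moreover have "inj_on (\<lambda>j. {2 * m, 2 * m + Suc j}) {..<d}"
      by (auto simp: inj_on_def doubleton_eq_iff)
    ultimately show "finite (star_edges (2 * m) d)" "card (star_edges (2 * m) d) = d"
      by (simp_all add: card_image)
  qed
  have "degree ?E v \<le> d" for v
  proof (cases "v < 2 * m")
    case True
    \<comment> \<open>A superset of the neighbours; truncated subtraction can only add spurious
      entries. A vertex of the second half finds its partners by the inverse permutations.\<close>
    define N where "N = {v + 1, v - 1, v + 2, v - 2} \<union>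
      (\<lambda>r. if v < m then m + \<sigma> r v else inv (\<sigma> r) (v - m)) ` {..<d - 4}"
    have "{e \<in> ?E. v \<in> e} \<subseteq> (\<lambda>w. {v, w}) ` N"
    proof
      fix e assume "e \<in> {e \<in> ?E. v \<in> e}"
      then have "e \<in> ?E" "v \<in> e" by auto
      then consider i where "e = {i, Suc i}" | i where "e = {i, i + 2}"
        | i r where "e = {i, m + \<sigma> r i}" "i < m" "r < d - 4"
        using True unfolding hard_edges_def frame_edges_def matching_edges_def star_edges_def by auto
      then show "e \<in> (\<lambda>w. {v, w}) ` N"
      proof cases
        case (1 i)
        then have "e = {v, v + 1} \<or> e = {v, v - 1}" using \<open>v \<in> e\<close> by (auto simp: insert_commute)
        then show ?thesis by (auto simp: N_def)
      next
        case (2 i)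
        then have "e = {v, v + 2} \<or> e = {v, v - 2}" using \<open>v \<in> e\<close> by (auto simp: insert_commute)
        then show ?thesis by (auto simp: N_def)
      next
        case (3 i r)
        show ?thesis
        proof (cases "v = i")
          case True
          then have "m + \<sigma> r v \<in> N" using 3 by (auto simp: N_def)
          then show ?thesis using 3 True by blast
        next
          case False
          then have v: "v = m + \<sigma> r i" using 3 \<open>v \<in> e\<close> by auto
          then have "inv (\<sigma> r) (v - m) = i" using permutes_inverses(2)[OF \<sigma>[OF 3(3)]] by simp
          then have "i \<in> N" using 3 v unfolding N_def by force
          then show ?thesis using 3 v by (auto simp: insert_commute)
        qed
      qed
    qed
    then have "degree ?E v \<le> card ((\<lambda>w. {v, w}) ` N)"
      unfolding degree_def by (intro card_mono) (auto simp: N_def)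
    also have "\<dots> \<le> card N" by (rule card_image_le) (simp add: N_def)
    also have "\<dots> \<le> card {v + 1, v - 1, v + 2, v - 2} + card ((\<lambda>r. if v < m then m + \<sigma> r v else inv (\<sigma> r) (v - m)) ` {..<d - 4})"
      unfolding N_def by (rule card_Un_le)
    also have "\<dots> \<le> 4 + card {..<d - 4}"
      by (intro add_mono card_image_le) (auto simp: card_insert_if)
    finally show ?thesis using d by simp
  next
    case False
    have "{e \<in> ?E. v \<in> e} \<subseteq> star_edges (2 * m) d"
      using False by (auto simp: hard_edges_def frame_edges_def matching_edges_def dest: \<sigma>m)
    then show ?thesis using card_mono[OF star(1)] star(2) by (simp add: degree_def)
  qed
  moreover have "degree ?E (2 * m) \<ge> d"
  proof -
    have "star_edges (2 * m) d \<subseteq> {e \<in> ?E. 2 * m \<in> e}" by (auto simp: hard_edges_def star_edges_def)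
    then have "card (star_edges (2 * m) d) \<le> card {e \<in> ?E. 2 * m \<in> e}"
      by (rule card_mono[rotated]) (simp add: finite_hard_edges)
    then show ?thesis by (simp add: degree_def star(2))
  qed
  ultimately have "degree ?E (2 * m) = d" "\<And>v. degree ?E v \<le> d" by (auto intro: le_antisym)
  moreover have "2 * m \<in> {..<n}" using n by simp
  ultimately show "max_degree {..<n} ?E = d"
    unfolding max_degree_def by (intro Max_eqI) (auto intro: rev_image_eqI)
qed

section \<open>Lower bounds on the slope number\<close>

lemma slope_number_hard_edges_ge_1:
  assumes "d > 0"
  shows "slope_number V (hard_edges d m \<sigma>) \<ge> 1"
proof -
  let ?E = "hard_edges d m \<sigma>"
  obtain p where p: "card (edge_slopes ?E p) \<le> slope_number V ?E"
    using slope_number_attained by blast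
  have "{2 * m, 2 * m + Suc 0} \<in> ?E" using assms by (auto simp: hard_edges_def star_edges_def)
  then have "edge_slopes ?E p \<noteq> {}" by (auto simp: edge_slopes_def)
  then have "card (edge_slopes ?E p) > 0"
    using finite_edge_slopes[OF finite_hard_edges] by (simp add: card_gt_0_iff)
  then show ?thesis using p by simp
qed

theorem theorem5p2:
  fixes d :: nat
  assumes "d \<ge> 5"
  shows "\<exists>\<epsilon> :: nat \<Rightarrow> real. \<epsilon> \<longlonglongrightarrow> 0 \<and>
    (\<forall>n>d. \<exists>(V :: nat set) E.
       simple_graph V E \<and> card V = n \<and> max_degree V E = d \<and>
       real (slope_number V E) \<ge> real n powr (1 / 2 - 1 / (real d - 2) - \<epsilon> n))"
proof -
  define a where "a = 1 / 2 - 1 / (real d - 2)"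
  have "a > 0" using assms by (simp add: a_def field_simps)
  obtain n0 where n0: "\<And>n k m. n \<ge> n0 \<Longrightarrow> 1 \<le> k \<and> real k \<le> real n powr a \<and> m = (n - d - 1) div 2 \<Longrightarrow>
    encoding_bound k m (d - 4)
    < fact m ^ (d - 4)"
    using eventually_permutations_exceed_encodings[OF assms]
    unfolding eventually_sequentially a_def[symmetric] by blast
  \<comment> \<open>The counting argument gives any exponent below \<open>(d - 4) / d\<close>, which exceeds \<open>a\<close>, so \<open>\<epsilon>\<close> may vanish
    eventually; for small \<open>n\<close> it cancels the whole exponent.\<close>
  define n1 where "n1 = max n0 (d + 5)"
  define \<epsilon> where "\<epsilon> n = (if n < n1 then a else 0)" for n
  have "\<forall>\<^sub>F n in sequentially. \<epsilon> n = 0"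
    using eventually_ge_at_top[of n1] by eventually_elim (simp add: \<epsilon>_def)
  then have "\<epsilon> \<longlonglongrightarrow> 0" by (rule tendsto_eventually)
  moreover have "\<exists>(V :: nat set) E. simple_graph V E \<and> card V = n \<and> max_degree V E = d \<and>
       real (slope_number V E) \<ge> real n powr (a - \<epsilon> n)" if n: "n > d" for n
  proof (cases "n < n1")
    case True
    \<comment> \<open>The star alone: \<open>\<epsilon> n = a\<close> leaves only the bound
      \<open>n powr 0 = 1\<close>.\<close>
    have "real (slope_number {..<n} (hard_edges d 0 (\<lambda>_. id))) \<ge> 1"
      using slope_number_hard_edges_ge_1[of d] assms by simp
    then show ?thesis using True hard_graph[of d 0 n "\<lambda>_. id"] assms n
      by (intro exI[of _ "{..<n}"] exI[of _ "hard_edges d 0 (\<lambda>_. id)"])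
        (simp add: \<epsilon>_def permutes_id)
  next
    case False
    \<comment> \<open>The largest frame that leaves room for the star; \<open>n \<ge> d + 5\<close>
      gives \<open>m \<ge> 2\<close>.\<close>
    define m where "m = (n - d - 1) div 2"
    have m: "m \<ge> 2" "2 * m + d < n" using False n by (auto simp: m_def n1_def)
    \<comment> \<open>Slope numbers are integers, so one below \<open>n powr a\<close> is at most
      \<open>k\<close>.\<close>
    define k where "k = nat \<lfloor>real n powr a\<rfloor>"
    have "real n powr 0 \<le> real n powr a" using n \<open>a > 0\<close> by (intro powr_mono) auto
    then have k: "1 \<le> k" "real k \<le> real n powr a"
      using n by (simp_all add: k_def le_nat_iff le_floor_iff)
    define \<Sigma> where "\<Sigma> = PiE {..<d - 4} (\<lambda>_. {\<pi>. \<pi> permutes {..<m}})"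
    have "\<exists>\<sigma>\<in>\<Sigma>. real n powr a \<le> real (slope_number {..<n} (hard_edges d m \<sigma>))"
    \<comment> \<open>If every tuple of matchings had a drawing with at most \<open>k\<close>
      slopes, every tuple would be encoded, against the count.\<close>
    proof (rule ccontr)
      assume "\<not> ?thesis"
      then have lt: "real (slope_number {..<n} (hard_edges d m \<sigma>)) < real n powr a" if "\<sigma> \<in> \<Sigma>" for \<sigma>
        using that by force
      have "\<exists>x c c' \<kappa>. encodes k m (d - 4) \<sigma> x c c' \<kappa>" if \<sigma>: "\<sigma> \<in> \<Sigma>" for \<sigma>
      proof -
        have le: "slope_number {..<n} (hard_edges d m \<sigma>) \<le> k"
          using lt[OF \<sigma>] by (simp add: k_def le_nat_iff le_floor_iff)
        obtain p where p: "straight_line_drawing {..<n} (hard_edges d m \<sigma>) p"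
          "card (edge_slopes (hard_edges d m \<sigma>) p) \<le> slope_number {..<n} (hard_edges d m \<sigma>)"
          using slope_number_attained by blast
        have \<sigma>m: "\<sigma> r i < m" if "r < d - 4" "i < m" for r i
        proof -
          have "\<sigma> r permutes {..<m}" using \<sigma> that(1) by (auto simp: \<Sigma>_def)
          then show ?thesis using permutes_in_image[of "\<sigma> r" "{..<m}" i] that(2) by simp
        qed
        show ?thesis
        proof (rule drawing_encoding[OF m(1) _ _ _ _ \<sigma>m p(1)])
          show "frame_edges (2 * m) \<union> matching_edges m (d - 4) \<sigma> \<subseteq> hard_edges d m \<sigma>"
            by (auto simp: hard_edges_def)
          show "card (edge_slopes (hard_edges d m \<sigma>) p) \<le> k" using p(2) le by simp
        qed (use k(1) m(2) finite_hard_edges in auto)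
      qed
      then have "fact m ^ (d - 4) \<le> encoding_bound k m (d - 4)"
        unfolding \<Sigma>_def by (rule permutation_tuples_le_encodings)
      moreover have "n \<ge> n0" using False by (simp add: n1_def)
      ultimately show False using n0[of n k m] k m_def by (meson leD)
    qed
    then obtain \<sigma> where \<sigma>: "\<sigma> \<in> \<Sigma>" "real n powr a \<le> real (slope_number {..<n} (hard_edges d m \<sigma>))"
      by blast
    have "\<sigma> r permutes {..<m}" if "r < d - 4" for r using \<sigma>(1) that by (auto simp: \<Sigma>_def)
    with hard_graph[of d m n \<sigma>] m(2) assms \<sigma>(2) False show ?thesis
      by (intro exI[of _ "{..<n}"] exI[of _ "hard_edges d m \<sigma>"]) (simp add: \<epsilon>_def)
  qed
  ultimately show ?thesis unfolding a_def by blast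
qed

end
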